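(* Let $F$ be a field of characteristic $3$, let $n\ge 1$, and let $P,R,S,T$ be nonsingular $n\times n$ matrices over $F$. Then the $2n\times 4n$ matrix $$M=\begin{pmatrix} P & R & S & T\\ P & R & S & T\end{pmatrix}$$ has full perrank, i.e. $M$ has a $2n\times 2n$ submatrix with nonzero permanent.
   Context: The perrank of a matrix $M$ of size $m\times N$ is the size of a largest square submatrix of $M$ with nonzero permanent; $M$ has full perrank if its perrank equals $m$ or $N$. *)

theory Defs
  imports "HOL-Combinatorics.Permutations"
begin

text \<open>Matrices are represented as functions nat \<Rightarrow> nat \<Rightarrow> 'a,
  with an m \<times> N matrix being given by its entries A i j for i < m, j < N
  (indices start at 0).\<close>

definition permanent :: "nat \<Rightarrow> (nat \<Rightarrow> nat \<Rightarrow> 'a::comm_semiring_1) \<Rightarrow> 'a" where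
  "permanent n A = (\<Sum>\<sigma> | \<sigma> permutes {..<n}. \<Prod>i<n. A i (\<sigma> i))"

definition det_n :: "nat \<Rightarrow> (nat \<Rightarrow> nat \<Rightarrow> 'a::comm_ring_1) \<Rightarrow> 'a" where
  "det_n n A = (\<Sum>\<sigma> | \<sigma> permutes {..<n}. of_int (sign \<sigma>) * (\<Prod>i<n. A i (\<sigma> i)))"

definition nonsingular :: "nat \<Rightarrow> (nat \<Rightarrow> nat \<Rightarrow> 'a::field) \<Rightarrow> bool" where
  "nonsingular n A \<longleftrightarrow> det_n n A \<noteq> 0"

definition submatrix :: "(nat \<Rightarrow> nat \<Rightarrow> 'a) \<Rightarrow> nat list \<Rightarrow> nat list \<Rightarrow> (nat \<Rightarrow> nat \<Rightarrow> 'a)" where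
  "submatrix A rs cs = (\<lambda>i j. A (rs ! i) (cs ! j))"

definition has_nonzero_perm_submatrix ::
  "nat \<Rightarrow> nat \<Rightarrow> (nat \<Rightarrow> nat \<Rightarrow> 'a::comm_semiring_1) \<Rightarrow> nat \<Rightarrow> bool" where
  "has_nonzero_perm_submatrix m N A k \<longleftrightarrow>
     (\<exists>rs cs. length rs = k \<and> length cs = k \<and> sorted_wrt (<) rs \<and> sorted_wrt (<) cs \<and>
        set rs \<subseteq> {..<m} \<and> set cs \<subseteq> {..<N} \<and> permanent k (submatrix A rs cs) \<noteq> 0)"

definition perrank :: "nat \<Rightarrow> nat \<Rightarrow> (nat \<Rightarrow> nat \<Rightarrow> 'a::comm_semiring_1) \<Rightarrow> nat" where
  "perrank m N A = Max {k. has_nonzero_perm_submatrix m N A k}"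

definition full_perrank :: "nat \<Rightarrow> nat \<Rightarrow> (nat \<Rightarrow> nat \<Rightarrow> 'a::comm_semiring_1) \<Rightarrow> bool" where
  "full_perrank m N A \<longleftrightarrow> perrank m N A = m \<or> perrank m N A = N"

text \<open>The 2n \<times> 4n block matrix [P R S T; P R S T].\<close>
definition block_PRST :: "nat \<Rightarrow> (nat \<Rightarrow> nat \<Rightarrow> 'a) \<Rightarrow> (nat \<Rightarrow> nat \<Rightarrow> 'a) \<Rightarrow>
    (nat \<Rightarrow> nat \<Rightarrow> 'a) \<Rightarrow> (nat \<Rightarrow> nat \<Rightarrow> 'a) \<Rightarrow> (nat \<Rightarrow> nat \<Rightarrow> 'a)" where
  "block_PRST n P R S T = (\<lambda>i j. let i' = i mod n in
      if j < n then P i' j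
      else if j < 2*n then R i' (j - n)
      else if j < 3*n then S i' (j - 2*n)
      else T i' (j - 3*n))"

end

theory Submission
  imports Defs "Jordan_Normal_Form.Determinant" "HOL-Library.Product_Plus" "HOL-Library.Function_Algebras"
    "HOL-Library.Multiset" "HOL-Library.FuncSet"
begin

text \<open>Let \<open>E\<close> be the set of the \<open>4n\<close> columns and let \<open>T = K[t_e | e \<in> E]/(t_e^2)\<close>. The rows \<open>y_1, \<dots>, y_n\<close> of
  \<open>(P R S T)\<close> give linear forms in \<open>T\<close>, and the coefficients of \<open>y_1^2 \<cdots> y_n^2\<close> are the maximal subpermanents of the
  doubled matrix. In characteristic 3 all cubes \<open>y_i^3\<close> vanish, so \<open>T\<close> is a graded module over
  \<open>A = K[y_1, \<dots>, y_n]/(y_i^3)\<close>. If no element of degree below \<open>2n\<close> is annihilated by all \<open>y_i\<close>, then 1 can be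
  multiplied by forms \<open>y_i\<close> without reaching 0 up to degree \<open>2n\<close>, where \<open>y_1^2 \<cdots> y_n^2\<close> is the only possible product.

  That socle is the zeroth cohomology \<open>Ext_A(K, T)\<close>, and \<open>T\<close> is a tensor product of the modules \<open>K[t_e]/(t_e^2)\<close>.
  The exact sequences \<open>0 \<rightarrow> K \<rightarrow> K[t]/(t^3) \<rightarrow> K[t]/(t^2) \<rightarrow> 0\<close>, whose middle term is coinduced from
  the forms vanishing at \<open>e\<close>, bound the degrees of the whole cohomology by deletion and contraction of columns. A surviving
  class ends with a space of \<open>r\<close> independent forms whose whole support has been deleted; as the forms stay independent
  on each of the four blocks, this support has at least \<open>4r\<close> elements.\<close>

section \<open>A complex for commuting operators with vanishing cubes\<close>

text \<open>For commuting operators with vanishing cubes, cochains are indexed by multi-indices. Entering an odd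
  index applies \<open>y\<close>, entering an even one applies \<open>y^2\<close>; the weight is the resulting degree shift.\<close>

primrec wt1 :: "nat \<Rightarrow> int" where
  "wt1 0 = 0"
| "wt1 (Suc q) = wt1 q + (if even q then 1 else 2)"

definition wt :: "nat list \<Rightarrow> int" where
  "wt a = sum_list (map wt1 a)"

lemma wt_simps [simp]: "wt [] = 0" "wt (p # a) = wt1 p + wt a"
  by (simp_all add: wt_def)

lemma wt1_bounds: "2 * wt1 p \<le> 3 * int p" "even p \<Longrightarrow> 2 * wt1 p = 3 * int p"
    "odd p \<Longrightarrow> 2 * wt1 p = 3 * int p - 1"
  by (induction p) auto

text \<open>The shifts alternate between 1 and 2, starting with 1, so their average never exceeds
  3/2. Once no column is left, this bound makes the degree of every cochain negative.\<close>

lemma wt_le: "2 * wt a \<le> 3 * int (sum_list a)"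
proof (induction a)
  case (Cons p a)
  then show ?case using wt1_bounds(1)[of p] by simp
qed simp

text \<open>The complex of homomorphisms from the resolution of \<open>K\<close> over
  \<open>K[y_1, ..., y_n]/(y_i^3)\<close>. For one variable that resolution is periodic, with maps
  alternating between \<open>y\<close> and \<open>y^2\<close>; for several it is the tensor product,
  with the signs of a total complex.\<close>

fun coboundary :: "('i \<Rightarrow> 'm::ab_group_add \<Rightarrow> 'm) \<Rightarrow> 'i list \<Rightarrow> (nat list \<Rightarrow> 'm) \<Rightarrow> nat list \<Rightarrow> 'm" where
  "coboundary v [] c a = 0"
| "coboundary v (y # ys) c [] = 0"
| "coboundary v (y # ys) c (p # a) =
    (case p of 0 \<Rightarrow> 0 | Suc q \<Rightarrow> if even q then v y (c (q # a)) else v y (v y (c (q # a))))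
    + (if even p then coboundary v ys (\<lambda>b. c (p # b)) a else - coboundary v ys (\<lambda>b. c (p # b)) a)"

definition indices :: "'i list \<Rightarrow> nat \<Rightarrow> nat list set" where
  "indices ys j = {a. length a = length ys \<and> sum_list a = j}"

text \<open>Vanishing of the \<open>j\<close>-th cohomology group in internal degree \<open>d\<close>.\<close>

definition cohomology_vanishes :: "('i \<Rightarrow> 'm::ab_group_add \<Rightarrow> 'm) \<Rightarrow> (int \<Rightarrow> 'm \<Rightarrow> bool) \<Rightarrow> 'i list \<Rightarrow> nat \<Rightarrow> int \<Rightarrow> bool" where
  "cohomology_vanishes v gr ys j d \<longleftrightarrow>
    (\<forall>c. (\<forall>a\<in>indices ys j. gr (d + wt a) (c a)) \<longrightarrow> (\<forall>a\<in>indices ys (Suc j). coboundary v ys c a = 0) \<longrightarrow>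
      (\<exists>b. (\<forall>a. length a = length ys \<longrightarrow> Suc (sum_list a) = j \<longrightarrow> gr (d + wt a) (b a))
        \<and> (\<forall>a\<in>indices ys j. c a = coboundary v ys b a)))"

section \<open>Functoriality of the complex\<close>

lemma coboundary_cong:
  assumes "\<And>b. length b = length a \<Longrightarrow> Suc (sum_list b) = sum_list a \<Longrightarrow> c b = c' b"
  shows "coboundary v ys c a = coboundary v ys c' a"
  using assms
proof (induction v ys c a arbitrary: c' rule: coboundary.induct)
  case (3 v y ys c p a)
  have "coboundary v ys (\<lambda>b. c (p # b)) a = coboundary v ys (\<lambda>b. c' (p # b)) a"
    using "3.prems" by (cases "even p") (intro "3.IH"; simp)+
  then show ?case using "3.prems" by (simp split: nat.split)
qed simp_all

text \<open>Each term of the coboundary lowers one entry of the index, and the zero index has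
  nothing to lower. So in cohomological degree 0, vanishing means that every cocycle is 0.\<close>

lemma coboundary_zero_index: "sum_list a = 0 \<Longrightarrow> coboundary v ys c a = 0"
  by (induction v ys c a rule: coboundary.induct) auto

text \<open>Additive maps that commute with the listed operators are module homomorphisms, and these
  induce cochain maps.\<close>

lemma coboundary_natural:
  assumes f_add: "\<And>x x'. f (x + x') = f x + f x'"
    and f_v: "\<And>y x. y \<in> set ys \<Longrightarrow> f (v y x) = w y (f x)"
  shows "coboundary w ys (\<lambda>a. f (c a)) a = f (coboundary v ys c a)"
proof -
  have f0: "f 0 = 0" using f_add[of 0 0] by simp
  have fm: "f (- x) = - f x" for x
    using f_add[of x "-x"] f0 by (simp add: eq_neg_iff_add_eq_0 add.commute)
  show ?thesis
    using f_v
  proof (induction ys arbitrary: c a)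
    case (Cons y ys)
    have IH: "coboundary w ys (\<lambda>a. f (c a)) a = f (coboundary v ys c a)" for c a
      by (rule Cons.IH, rule Cons.prems) simp
    show ?case
    proof (cases a)
      case (Cons p a')
      then show ?thesis by (auto simp: f_add f0 fm IH Cons.prems[symmetric] split: nat.split)
    qed (simp add: f0)
  qed (simp add: f0)
qed

lemma coboundary_map: "coboundary v (map g ys) c a = coboundary (\<lambda>y. v (g y)) ys c a"
proof (induction ys arbitrary: c a)
  case (Cons y ys)
  show ?case by (cases a) (auto simp: Cons.IH split: nat.split)
qed simp

lemma vanishes_cong:
  assumes "\<And>y x. y \<in> set ys \<Longrightarrow> v y x = w y x"
  shows "cohomology_vanishes v gr ys j d \<longleftrightarrow> cohomology_vanishes w gr ys j d"
proof -
  have "coboundary w ys c a = coboundary v ys c a" for c a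
    using coboundary_natural[of id ys v w c a] assms by simp
  then show ?thesis by (simp add: cohomology_vanishes_def)
qed

lemma vanishes_map: "cohomology_vanishes v gr (map g ys) j d \<longleftrightarrow> cohomology_vanishes (\<lambda>y. v (g y)) gr ys j d"
  by (simp add: cohomology_vanishes_def indices_def coboundary_map)

section \<open>Cochains with values in a graded module\<close>

definition step :: "('m \<Rightarrow> 'm) \<Rightarrow> nat \<Rightarrow> 'm \<Rightarrow> 'm" where
  "step f q x = (if even q then f x else f (f x))"

definition alt :: "nat \<Rightarrow> 'm::ab_group_add \<Rightarrow> 'm" where
  "alt p x = (if even p then x else - x)"

lemma coboundary_Cons_0: "coboundary v (y # ys) c (0 # a) = coboundary v ys (\<lambda>b. c (0 # b)) a"
  by simp

lemma coboundary_Cons_Suc: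
  "coboundary v (y # ys) c (Suc q # a) = step (v y) q (c (q # a)) + alt (Suc q) (coboundary v ys (\<lambda>b. c (Suc q # b)) a)"
  by (simp add: step_def alt_def)

text \<open>A graded module over the truncated polynomial algebra, with \<open>gr k\<close> marking
  the elements of degree \<open>k\<close>. Every value of the index type acts, and a list
  \<open>ys\<close> selects the variables; so forms can be replaced by combinations of them without
  changing the module.\<close>

locale graded_operators =
  fixes v :: "'i \<Rightarrow> 'm::ab_group_add \<Rightarrow> 'm" and gr :: "int \<Rightarrow> 'm \<Rightarrow> bool"
  assumes v_add: "v y (x + x') = v y x + v y x'"
    and v_comm: "v y (v z x) = v z (v y x)"
    and v_cube: "v y (v y (v y x)) = 0"
    and gr_zero: "gr k 0"
    and gr_diff: "gr k x \<Longrightarrow> gr k x' \<Longrightarrow> gr k (x - x')"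
    and gr_v: "gr k x \<Longrightarrow> gr (k + 1) (v y x)"
begin

lemma v_zero [simp]: "v y 0 = 0"
  using v_add[of y 0 0] by simp

lemma v_minus: "v y (- x) = - v y x"
  using v_add[of y x "-x"] by (simp add: eq_neg_iff_add_eq_0 add.commute)

lemma v_diff: "v y (x - x') = v y x - v y x'"
  using v_add[of y x "- x'"] v_minus by simp

lemma gr_minus: "gr k x \<Longrightarrow> gr k (- x)"
  using gr_diff[OF gr_zero, of k x] by simp

lemma gr_add: "gr k x \<Longrightarrow> gr k x' \<Longrightarrow> gr k (x + x')"
  using gr_diff[of k x "- x'"] gr_minus by simp

lemma gr_alt: "gr k x \<Longrightarrow> gr k (alt p x)"
  by (simp add: alt_def gr_minus)

lemma gr_step: "gr (k + wt1 q) x \<Longrightarrow> gr (k + wt1 (Suc q)) (step (v y) q x)"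
  using gr_v[of "k + wt1 q" x y] gr_v[of "k + wt1 q + 1" "v y x" y]
  by (auto simp: step_def add.assoc)

lemma step_zero [simp]: "step (v y) q 0 = 0"
  by (simp add: step_def)

lemma step_add: "step (v y) q (x + x') = step (v y) q x + step (v y) q x'"
  by (simp add: step_def v_add)

lemma step_alt: "step (v y) q (alt p x) = alt p (step (v y) q x)"
  by (simp add: step_def alt_def v_minus)

lemma step_step: "step (v y) (Suc q) (step (v y) q x) = 0"
  by (simp add: step_def v_cube)

lemma coboundary_zero: "coboundary v ys (\<lambda>b. 0) a = 0"
proof (induction ys arbitrary: a)
  case (Cons y ys)
  show ?case by (cases a) (auto simp: Cons.IH split: nat.split)
qed simp

lemma coboundary_add: "coboundary v ys (\<lambda>b. c b + c' b) a = coboundary v ys c a + coboundary v ys c' a"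
proof (induction ys arbitrary: c c' a)
  case (Cons y ys)
  show ?case by (cases a) (auto simp: Cons.IH v_add algebra_simps split: nat.split)
qed simp

lemma coboundary_minus: "coboundary v ys (\<lambda>b. - c b) a = - coboundary v ys c a"
proof (induction ys arbitrary: c a)
  case (Cons y ys)
  show ?case by (cases a) (auto simp: Cons.IH v_minus split: nat.split)
qed simp

lemma coboundary_diff: "coboundary v ys (\<lambda>b. c b - c' b) a = coboundary v ys c a - coboundary v ys c' a"
  using coboundary_add[of ys c "\<lambda>b. - c' b"] by (simp add: coboundary_minus)

lemma coboundary_alt: "coboundary v ys (\<lambda>b. alt p (c b)) a = alt p (coboundary v ys c a)"
  by (simp add: alt_def coboundary_minus)

lemma coboundary_step: "coboundary v ys (\<lambda>b. step (v y) q (c b)) a = step (v y) q (coboundary v ys c a)"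
  by (rule coboundary_natural) (simp_all add: step_def v_add v_comm)

text \<open>Two consecutive steps in one coordinate compose to \<open>y^3 = 0\<close>. The mixed
  terms occur twice with opposite signs, as raising the first index flips the sign of the remaining
  differential.\<close>

lemma coboundary_coboundary: "coboundary v ys (coboundary v ys c) a = 0"
proof (induction ys arbitrary: c a)
  case (Cons y ys)
  have *: "coboundary v ys (\<lambda>b. step (v y) q (c (q # b)) + alt (Suc q) (coboundary v ys (\<lambda>b. c (Suc q # b)) b)) a
      = step (v y) q (coboundary v ys (\<lambda>b. c (q # b)) a)" for q a
    by (simp add: coboundary_add coboundary_step coboundary_alt Cons.IH) (simp add: alt_def)
  show ?case
  proof (cases a)
    case (Cons p a')
    show ?thesis
    proof (cases p)
      case 0
      have "coboundary v (y # ys) (coboundary v (y # ys) c) (0 # a') = coboundary v ys (coboundary v ys (\<lambda>b. c (0 # b))) a'"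
        by simp
      then show ?thesis using Cons.IH by (simp only: Cons 0)
    next
      case (Suc q)
      have "step (v y) q (coboundary v (y # ys) c (q # a')) = alt q (step (v y) q (coboundary v ys (\<lambda>b. c (q # b)) a'))"
        by (cases q) (simp only: coboundary_Cons_0, simp add: alt_def,
            simp only: coboundary_Cons_Suc step_add step_alt step_step add_0)
      moreover have "coboundary v ys (\<lambda>b. coboundary v (y # ys) c (Suc q # b)) a' = step (v y) q (coboundary v ys (\<lambda>b. c (q # b)) a')"
        unfolding coboundary_Cons_Suc by (rule *)
      ultimately have "coboundary v (y # ys) (coboundary v (y # ys) c) (Suc q # a') = 0"
        unfolding coboundary_Cons_Suc[of v y ys "coboundary v (y # ys) c"] by (simp add: alt_def)
      then show ?thesis
        by (simp only: Cons Suc)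
    qed
  qed simp
qed simp

lemma gr_coboundary:
  assumes "\<And>b. length b = length a \<Longrightarrow> Suc (sum_list b) = sum_list a \<Longrightarrow> gr (d + wt b) (c b)"
  shows "gr (d + wt a) (coboundary v ys c a)"
  using assms
proof (induction ys arbitrary: c a d)
  case (Cons y ys)
  show ?case
  proof (cases a)
    case (Cons p a')
    have 1: "gr (d + wt1 p + wt a') (coboundary v ys (\<lambda>b. c (p # b)) a')"
    proof (rule Cons.IH)
      fix b :: "nat list" assume "length b = length a'" "Suc (sum_list b) = sum_list a'"
      then show "gr (d + wt1 p + wt b) (c (p # b))"
        using Cons.prems[of "p # b"] Cons by (simp add: add.assoc)
    qed
    show ?thesis
    proof (cases p)
      case 0
      then show ?thesis using 1 Cons by simp
    next
      case (Suc q)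
      have "gr (d + wt a' + wt1 q) (c (q # a'))"
        using Cons.prems[of "q # a'"] Cons Suc by (simp add: algebra_simps)
      from gr_step[OF this, of y] have "gr (d + wt1 p + wt a') (step (v y) q (c (q # a')))"
        using Suc by (simp add: algebra_simps)
      from gr_add[OF this gr_alt[OF 1, of p]] show ?thesis
        by (simp only: Cons Suc coboundary_Cons_Suc wt_simps add.assoc)
    qed
  qed (simp add: gr_zero)
qed (simp add: gr_zero)

text \<open>Where \<open>h\<close> acts freely, cohomology collapses onto the kernel of \<open>h\<close>: the components of a cocycle
  with positive first index are removed one at a time, from the top index downwards.\<close>

lemma vanishes_Cons:
  assumes s2: "\<And>k x. gr k x \<Longrightarrow> v h x = 0 \<Longrightarrow> v h (v h (\<tau> x)) = x \<and> gr (k - 2) (\<tau> x)"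
    and s1: "\<And>k x. gr k x \<Longrightarrow> v h (v h x) = 0 \<Longrightarrow> v h (\<rho> x) = x \<and> gr (k - 1) (\<rho> x)"
    and ker: "\<And>c. \<forall>a\<in>indices ys j. gr (d + wt a) (c a) \<and> v h (c a) = 0 \<Longrightarrow>
        \<forall>a\<in>indices ys (Suc j). coboundary v ys c a = 0 \<Longrightarrow>
        \<exists>b. (\<forall>a. length a = length ys \<longrightarrow> Suc (sum_list a) = j \<longrightarrow> gr (d + wt a) (b a) \<and> v h (b a) = 0)
          \<and> (\<forall>a\<in>indices ys j. c a = coboundary v ys b a)"
  shows "cohomology_vanishes v gr (h # ys) j d"
proof -
  \<comment> \<open>The periodic sequence of \<open>h\<close> is exact: \<open>\<rho>\<close> shows
    that the kernel of \<open>h^2\<close> is the image of \<open>h\<close>, and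
    \<open>\<tau>\<close> that the kernel of \<open>h\<close> is the image of
    \<open>h^2\<close>.\<close>
  have s: "\<exists>x'. step (v h) q x' = x \<and> gr (k + wt1 q) x'"
    if "gr (k + wt1 (Suc q)) x" "step (v h) (Suc q) x = 0" for k q x
  proof (cases "even q")
    case True
    with that s1[of "k + wt1 (Suc q)" x] show ?thesis
      by (intro exI[of _ "\<rho> x"]) (auto simp: step_def algebra_simps)
  next
    case False
    with that s2[of "k + wt1 (Suc q)" x] show ?thesis
      by (intro exI[of _ "\<tau> x"]) (auto simp: step_def algebra_simps)
  qed
  \<comment> \<open>\<open>m\<close> bounds the first indices at which \<open>c\<close> is nonzero.
    In cohomological degree \<open>j\<close> the bound \<open>m = j\<close> always holds.\<close>
  have main: "\<exists>b. (\<forall>a. length a = length (h # ys) \<longrightarrow> Suc (sum_list a) = j \<longrightarrow> gr (d + wt a) (b a))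
       \<and> (\<forall>a\<in>indices (h # ys) j. c a = coboundary v (h # ys) b a)"
    if "\<forall>a\<in>indices (h # ys) j. gr (d + wt a) (c a)" "\<forall>a\<in>indices (h # ys) (Suc j). coboundary v (h # ys) c a = 0"
      "\<forall>p a. p > m \<longrightarrow> p # a \<in> indices (h # ys) j \<longrightarrow> c (p # a) = 0" for m c
    using that
  proof (induction m arbitrary: c)
    case 0
    note gc = 0(1)[rule_format] and zc = 0(2)[rule_format] and vc = 0(3)[rule_format]
    \<comment> \<open>The component at first index 1 is zero, so the cocycle condition there says
      that \<open>h\<close> annihilates the component at first index 0.\<close>
    have 1: "gr (d + wt a) (c (0 # a)) \<and> v h (c (0 # a)) = 0" if "a \<in> indices ys j" for a
    proof -
      have "coboundary v ys (\<lambda>b. c (Suc 0 # b)) a = coboundary v ys (\<lambda>b. 0) a"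
        by (rule coboundary_cong) (use that vc in \<open>auto simp: indices_def\<close>)
      then show ?thesis
        using gc[of "0 # a"] zc[of "Suc 0 # a"] that
        by (auto simp: indices_def coboundary_zero)
    qed
    have 2: "coboundary v ys (\<lambda>b. c (0 # b)) a = 0" if "a \<in> indices ys (Suc j)" for a
      using zc[of "0 # a"] that by (auto simp: indices_def)
    have "\<exists>b. (\<forall>a. length a = length ys \<longrightarrow> Suc (sum_list a) = j \<longrightarrow> gr (d + wt a) (b a) \<and> v h (b a) = 0)
          \<and> (\<forall>a\<in>indices ys j. c (0 # a) = coboundary v ys b a)"
      by (rule ker) (use 1 2 in blast)+
    then obtain b where b: "\<And>a. length a = length ys \<Longrightarrow> Suc (sum_list a) = j \<Longrightarrow> gr (d + wt a) (b a) \<and> v h (b a) = 0"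
        "\<And>a. a \<in> indices ys j \<Longrightarrow> c (0 # a) = coboundary v ys b a"
      by blast
    \<comment> \<open>Extension by zero creates no term at first index 1, since the values of
      \<open>b\<close> lie in the kernel of \<open>h\<close>.\<close>
    define b' where "b' = (\<lambda>a. case a of [] \<Rightarrow> 0 | p # a' \<Rightarrow> if p = 0 then b a' else 0)"
    show ?case
    proof (intro exI[of _ b'] conjI allI impI ballI)
      fix a assume "length a = length (h # ys)" "Suc (sum_list a) = j"
      then show "gr (d + wt a) (b' a)"
        using b(1)[of "tl a"] by (auto simp: b'_def gr_zero split: list.split)
    next
      fix a assume a: "a \<in> indices (h # ys) j"
      then obtain p a' where pa: "a = p # a'" "length a' = length ys" "p + sum_list a' = j"
        by (cases a) (auto simp: indices_def)
      have b'0: "(\<lambda>x. b' (0 # x)) = b" and b'S: "(\<lambda>x. b' (Suc q # x)) = (\<lambda>x. 0)" for q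
        by (auto simp: b'_def)
      show "c a = coboundary v (h # ys) b' a"
      proof (cases p)
        case 0
        then show ?thesis using pa b(2)[of a'] by (simp add: b'0 indices_def)
      next
        case (Suc q)
        have "step (v h) q (b' (q # a')) = 0"
          using b(1)[of a'] pa Suc by (cases q) (auto simp: b'_def step_def)
        then show ?thesis
          unfolding pa Suc coboundary_Cons_Suc b'S
          using vc[of "Suc q" a'] a pa Suc by (simp add: coboundary_zero alt_def)
      qed
    qed
  next
    case (Suc q)
    note gc = Suc.prems(1)[rule_format] and zc = Suc.prems(2)[rule_format] and vc = Suc.prems(3)[rule_format]
    have "\<exists>x'. step (v h) q x' = c (Suc q # a) \<and> gr (d + wt a + wt1 q) x'"
      if a: "Suc q # a \<in> indices (h # ys) j" for a
    proof (rule s)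
      show "gr (d + wt a + wt1 (Suc q)) (c (Suc q # a))"
        using gc[OF a] by (simp add: algebra_simps)
      \<comment> \<open>Nothing lives above the top index, so the cocycle condition one index higher
        only sees the step of the top component.\<close>
      have "coboundary v ys (\<lambda>b. c (Suc (Suc q) # b)) a = coboundary v ys (\<lambda>b. 0) a"
        by (rule coboundary_cong) (use a vc in \<open>auto simp: indices_def\<close>)
      moreover have "coboundary v (h # ys) c (Suc (Suc q) # a) = 0"
        by (rule zc) (use a in \<open>auto simp: indices_def\<close>)
      ultimately show "step (v h) (Suc q) (c (Suc q # a)) = 0"
        unfolding coboundary_Cons_Suc by (simp add: coboundary_zero alt_def split: if_splits)
    qed
    then obtain \<beta> where \<beta>: "\<And>a. Suc q # a \<in> indices (h # ys) j \<Longrightarrow>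
        step (v h) q (\<beta> a) = c (Suc q # a) \<and> gr (d + wt a + wt1 q) (\<beta> a)"
      by metis
    \<comment> \<open>The coboundary of this cochain equals \<open>c\<close> at first index
      \<open>Suc q\<close> and is zero above, so subtracting it lowers the bound to
      \<open>q\<close>.\<close>
    define b' where "b' = (\<lambda>a. case a of [] \<Rightarrow> 0 | p # a' \<Rightarrow> if p = q then \<beta> a' else 0)"
    have gb': "gr (d + wt a) (b' a)" if "length a = length (h # ys)" "Suc (sum_list a) = j" for a
      using \<beta>[of "tl a"] that by (auto simp: b'_def gr_zero indices_def algebra_simps split: list.split)
    have b'0: "(\<lambda>x. b' (p # x)) = (\<lambda>x. 0)" if "p > q" for p
      using that by (auto simp: b'_def)
    obtain b'' where b'': "\<And>a. length a = length (h # ys) \<Longrightarrow> Suc (sum_list a) = j \<Longrightarrow> gr (d + wt a) (b'' a)"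
       "\<And>a. a \<in> indices (h # ys) j \<Longrightarrow> c a - coboundary v (h # ys) b' a = coboundary v (h # ys) b'' a"
    proof -
      have "\<exists>b. (\<forall>a. length a = length (h # ys) \<longrightarrow> Suc (sum_list a) = j \<longrightarrow> gr (d + wt a) (b a))
         \<and> (\<forall>a\<in>indices (h # ys) j. c a - coboundary v (h # ys) b' a = coboundary v (h # ys) b a)"
      proof (rule Suc.IH, safe)
        fix a assume a: "a \<in> indices (h # ys) j"
        show "gr (d + wt a) (c a - coboundary v (h # ys) b' a)"
          by (rule gr_diff[OF gc[OF a]], rule gr_coboundary, rule gb') (use a in \<open>auto simp: indices_def\<close>)
      next
        fix a assume "a \<in> indices (h # ys) (Suc j)"
        then show "coboundary v (h # ys) (\<lambda>a. c a - coboundary v (h # ys) b' a) a = 0"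
          using zc by (simp only: coboundary_diff coboundary_coboundary diff_zero)
      next
        fix p a assume p: "p > q" and a: "p # a \<in> indices (h # ys) j"
        obtain p' where p': "p = Suc p'" using p by (cases p) auto
        show "c (p # a) - coboundary v (h # ys) b' (p # a) = 0"
        proof (cases "p' = q")
          case True
          then show ?thesis using \<beta>[of a] a p' b'0[of p] p
            unfolding p' coboundary_Cons_Suc by (simp add: coboundary_zero alt_def) (simp add: b'_def)
        next
          case False
          then show ?thesis using vc[of p a] a p' b'0[of p] p
            unfolding p' coboundary_Cons_Suc by (simp add: coboundary_zero alt_def) (simp add: b'_def)
        qed
      qed
      then show thesis using that by blast
    qed
    show ?case
    proof (intro exI[of _ "\<lambda>a. b' a + b'' a"] conjI allI impI ballI)
      fix a assume "length a = length (h # ys)" "Suc (sum_list a) = j"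
      then show "gr (d + wt a) (b' a + b'' a)" by (intro gr_add gb' b''(1))
    next
      fix a assume "a \<in> indices (h # ys) j"
      from b''(2)[OF this] show "c a = coboundary v (h # ys) (\<lambda>a. b' a + b'' a) a"
        by (simp add: coboundary_add algebra_simps del: coboundary.simps)
    qed
  qed
  show ?thesis
    unfolding cohomology_vanishes_def
  proof (intro allI impI)
    fix c assume *: "\<forall>a\<in>indices (h # ys) j. gr (d + wt a) (c a)" "\<forall>a\<in>indices (h # ys) (Suc j). coboundary v (h # ys) c a = 0"
    show "\<exists>b. (\<forall>a. length a = length (h # ys) \<longrightarrow> Suc (sum_list a) = j \<longrightarrow> gr (d + wt a) (b a))
       \<and> (\<forall>a\<in>indices (h # ys) j. c a = coboundary v (h # ys) b a)"
      by (rule main[OF *, of j]) (auto simp: indices_def)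
  qed
qed

end

section \<open>Reordering the operators\<close>

text \<open>Exchange of two adjacent tensor factors with the Koszul sign
  \<open>(-1)^(p * q)\<close>. Positions outside the list are left alone.\<close>

fun swap_at :: "nat \<Rightarrow> (nat list \<Rightarrow> 'm::ab_group_add) \<Rightarrow> nat list \<Rightarrow> 'm" where
  "swap_at 0 c (p # q # a) = alt (p * q) (c (q # p # a))"
| "swap_at (Suc k) c (p # a) = swap_at k (\<lambda>b. c (p # b)) a"
| "swap_at k c a = c a"

fun swap_idx :: "nat \<Rightarrow> 'b list \<Rightarrow> 'b list" where
  "swap_idx 0 (p # q # a) = q # p # a"
| "swap_idx (Suc k) (p # a) = p # swap_idx k a"
| "swap_idx k a = a"

lemma swap_idx_invariants:
  "sum_list (swap_idx k (a :: nat list)) = sum_list a" "wt (swap_idx k a) = wt a"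
  by (induction k a rule: swap_idx.induct) simp_all

lemma length_swap_idx [simp]: "length (swap_idx k xs) = length xs"
  by (induction k xs rule: swap_idx.induct) simp_all

lemma swap_at_cong: "c (swap_idx k a) = c' (swap_idx k a) \<Longrightarrow> swap_at k c a = swap_at k c' a"
  by (induction k c a arbitrary: c' rule: swap_at.induct) auto

lemma swap_at_swap_at: "swap_at k (swap_at k c) a = c a"
proof (induction k c a rule: swap_at.induct)
  case (1 c p q a)
  show ?case by (auto simp: alt_def mult.commute)
qed auto

lemma swap_at_cases: "swap_at k c a = c (swap_idx k a) \<or> swap_at k c a = - c (swap_idx k a)"
  by (induction k c a rule: swap_at.induct) (auto simp: alt_def)

lemma swap_at_step:
  assumes "\<And>x. f (- x) = - f x" 
  shows "swap_at k (\<lambda>b. f (c b)) a = f (swap_at k c a)"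
  by (induction k c a rule: swap_at.induct) (auto simp: alt_def assms)

context graded_operators
begin

text \<open>Lowering \<open>p\<close> by one changes \<open>p * q\<close> by \<open>q\<close>, which
  cancels the sign \<open>(-1)^q\<close> that the exchanged order puts before the step in that
  coordinate; likewise for \<open>q\<close>. Later coordinates carry the sign
  \<open>(-1)^(p + q)\<close> in both orders.\<close>

lemma coboundary_swap_at:
  assumes "Suc k < length ys" "length a = length ys"
  shows "coboundary v (swap_idx k ys) (swap_at k c) a = swap_at k (coboundary v ys c) a"
  using assms
proof (induction k arbitrary: ys c a)
  case 0
  obtain y z zs where ys: "ys = y # z # zs" using 0 by (cases ys; cases "tl ys") auto
  obtain p q a' where a: "a = p # q # a'" using 0 ys by (cases a; cases "tl a") auto
  show ?case
  proof (cases p)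
    case p: 0
    show ?thesis
    proof (cases q)
      case 0
      then show ?thesis by (simp add: ys a p alt_def)
    next
      case (Suc q')
      then show ?thesis by (simp add: ys a p alt_def)
    qed
  next
    case p: (Suc p')
    show ?thesis
    proof (cases q)
      case 0
      then show ?thesis by (simp add: ys a p alt_def)
    next
      case (Suc q')
      then show ?thesis
        by (cases "even p'"; cases "even q'") 
          (simp_all add: ys a p alt_def coboundary_minus v_minus algebra_simps)
    qed
  qed
next
  case (Suc k)
  obtain y zs where ys: "ys = y # zs" using Suc.prems by (cases ys) auto
  obtain p a' where a: "a = p # a'" using Suc.prems ys by (cases a) auto
  have IH: "coboundary v (swap_idx k zs) (swap_at k c) a' = swap_at k (coboundary v zs c) a'" for c
    using Suc.IH[of zs a' c] Suc.prems ys a by simp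
  have add: "swap_at k (\<lambda>b. c b + c' b) a' = swap_at k c a' + swap_at k c' a'" for c c' :: "nat list \<Rightarrow> 'm"
    by (induction k c a' arbitrary: c' rule: swap_at.induct) (auto simp: alt_def)
  have st: "swap_at k (\<lambda>b. step (v y) q (c b)) a' = step (v y) q (swap_at k c a')" for q c
    by (rule swap_at_step) (simp add: step_def v_minus)
  have al: "swap_at k (\<lambda>b. alt q (c b)) a' = alt q (swap_at k c a')" for q and c :: "nat list \<Rightarrow> 'm"
    by (rule swap_at_step) (simp add: alt_def)
  show ?case
  proof (cases p)
    case 0
    then show ?thesis by (simp add: ys a IH)
  next
    case (Suc q)
    have "swap_at (Suc k) (coboundary v ys c) a
       = swap_at k (\<lambda>b. step (v y) q (c (q # b)) + alt (Suc q) (coboundary v zs (\<lambda>b. c (Suc q # b)) b)) a'"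
      unfolding ys a Suc swap_at.simps coboundary_Cons_Suc ..
    moreover have "coboundary v (swap_idx (Suc k) ys) (swap_at (Suc k) c) a
       = step (v y) q (swap_at k (\<lambda>b. c (q # b)) a') + alt (Suc q) (coboundary v (swap_idx k zs) (swap_at k (\<lambda>b. c (Suc q # b))) a')"
      unfolding ys a Suc swap_idx.simps coboundary_Cons_Suc swap_at.simps ..
    ultimately show ?thesis by (simp only: add st al IH)
  qed
qed

lemma gr_swap_at: "gr (d + wt (swap_idx k a)) (c (swap_idx k a)) \<Longrightarrow> gr (d + wt a) (swap_at k c a)"
  using swap_at_cases[of k c a] by (auto simp: swap_idx_invariants gr_minus)

lemma vanishes_swap:
  assumes k: "Suc k < length ys" and "cohomology_vanishes v gr ys j d"
  shows "cohomology_vanishes v gr (swap_idx k ys) j d"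
  unfolding cohomology_vanishes_def
proof (intro allI impI)
  fix c assume c: "\<forall>a\<in>indices (swap_idx k ys) j. gr (d + wt a) (c a)"
    "\<forall>a\<in>indices (swap_idx k ys) (Suc j). coboundary v (swap_idx k ys) c a = 0"
  have ii: "swap_idx k (swap_idx k x) = x" for x :: "'b list"
    by (induction k x rule: swap_idx.induct) auto
  have gc: "gr (d + wt a) (swap_at k c a)" if "a \<in> indices ys j" for a
    by (rule gr_swap_at, rule c(1)[rule_format]) (use that in \<open>auto simp: indices_def swap_idx_invariants\<close>)
  have "coboundary v ys (swap_at k c) a = 0" if a: "a \<in> indices ys (Suc j)" for a
  proof -
    have "coboundary v ys (swap_at k c) a = swap_at k (coboundary v (swap_idx k ys) c) a"
      using coboundary_swap_at[of k "swap_idx k ys" a c] k a by (simp add: ii indices_def swap_idx_invariants)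
    also have "\<dots> = 0"
      using swap_at_cases[of k "coboundary v (swap_idx k ys) c" a] c(2) a
      by (auto simp: indices_def swap_idx_invariants)
    finally show ?thesis .
  qed
  with gc have "\<exists>b. (\<forall>a. length a = length ys \<longrightarrow> Suc (sum_list a) = j \<longrightarrow> gr (d + wt a) (b a)) \<and>
      (\<forall>a\<in>indices ys j. swap_at k c a = coboundary v ys b a)"
    by (intro assms(2)[unfolded cohomology_vanishes_def, rule_format]) auto
  then obtain b where b:
    "\<And>a. length a = length ys \<Longrightarrow> Suc (sum_list a) = j \<Longrightarrow> gr (d + wt a) (b a)"
    "\<And>a. a \<in> indices ys j \<Longrightarrow> swap_at k c a = coboundary v ys b a"
    by blast
  show "\<exists>b. (\<forall>a. length a = length (swap_idx k ys) \<longrightarrow> Suc (sum_list a) = j \<longrightarrow> gr (d + wt a) (b a)) \<and>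
      (\<forall>a\<in>indices (swap_idx k ys) j. c a = coboundary v (swap_idx k ys) b a)"
  proof (intro exI[of _ "swap_at k b"] conjI allI impI ballI)
    fix a assume "length a = length (swap_idx k ys)" "Suc (sum_list a) = j"
    then show "gr (d + wt a) (swap_at k b a)"
      by (intro gr_swap_at b(1)) (auto simp: swap_idx_invariants)
  next
    fix a assume a: "a \<in> indices (swap_idx k ys) j"
    have "c a = swap_at k (swap_at k c) a" by (simp add: swap_at_swap_at)
    also have "\<dots> = swap_at k (coboundary v ys b) a"
      by (rule swap_at_cong, rule b(2)) (use a in \<open>auto simp: indices_def swap_idx_invariants\<close>)
    also have "\<dots> = coboundary v (swap_idx k ys) (swap_at k b) a"
      by (rule coboundary_swap_at[symmetric]) (use k a in \<open>auto simp: indices_def swap_idx_invariants\<close>)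
    finally show "c a = coboundary v (swap_idx k ys) (swap_at k b) a" .
  qed
qed

text \<open>Adjacent swaps carry \<open>y\<close> through \<open>pre\<close>. Thus any form with a
  nonzero coefficient at the current column may be treated as the first one.\<close>

lemma vanishes_move_to_front:
  assumes "cohomology_vanishes v gr (y # pre @ post) j d"
  shows "cohomology_vanishes v gr (pre @ y # post) j d"
  using assms
proof (induction pre arbitrary: post rule: rev_induct)
  case (snoc z pre)
  have "swap_idx (length xs) (xs @ p # q # r) = xs @ q # p # r" for xs and p q :: 'i and r
    by (induction xs) auto
  moreover have "cohomology_vanishes v gr (pre @ y # z # post) j d"
    using snoc by simp
  ultimately show ?case
    using vanishes_swap[of "length pre" "pre @ y # z # post"] by simp
qed simp

end

section \<open>Extensions by a truncated polynomial variable\<close>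

text \<open>\<open>v2\<close> and \<open>v3\<close> are the diagonal actions \<open>v y + s y \<cdot> t\<close> on \<open>N[t]/(t^2)\<close> and \<open>N[t]/(t^3)\<close>,
  written in coefficients with respect to powers of \<open>t\<close>; \<open>t\<close> has degree 1.\<close>

locale graded_operators_scaled = graded_operators v gr
  for v :: "'i \<Rightarrow> 'm::ab_group_add \<Rightarrow> 'm" and gr +
  fixes s :: "'i \<Rightarrow> 'm \<Rightarrow> 'm" and h :: 'i
  assumes s_add: "s y (x + x') = s y x + s y x'"
    and s_comm: "s y (s z x) = s z (s y x)"
    and s_v: "s y (v z x) = v z (s y x)"
    and gr_s: "gr k x \<Longrightarrow> gr k (s y x)"
    and s_h: "s h x = x"
    and char3: "(x :: 'm) + x + x = 0"
begin

lemma s_zero [simp]: "s y 0 = 0"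
  using s_add[of y 0 0] by simp

lemma s_minus: "s y (- x) = - s y x"
  using s_add[of y x "-x"] by (simp add: eq_neg_iff_add_eq_0 add.commute)

definition v2 :: "'i \<Rightarrow> 'm \<times> 'm \<Rightarrow> 'm \<times> 'm" where
  "v2 y = (\<lambda>(x0, x1). (v y x0, s y x0 + v y x1))"

definition gr2 :: "int \<Rightarrow> 'm \<times> 'm \<Rightarrow> bool" where
  "gr2 k = (\<lambda>(x0, x1). gr k x0 \<and> gr (k - 1) x1)"

definition v3 :: "'i \<Rightarrow> 'm \<times> 'm \<times> 'm \<Rightarrow> 'm \<times> 'm \<times> 'm" where
  "v3 y = (\<lambda>(x0, x1, x2). (v y x0, s y x0 + v y x1, s y x1 + v y x2))"

definition gr3 :: "int \<Rightarrow> 'm \<times> 'm \<times> 'm \<Rightarrow> bool" where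
  "gr3 k = (\<lambda>(x0, x1, x2). gr k x0 \<and> gr (k - 1) x1 \<and> gr (k - 2) x2)"

lemma char3': "x + (x + x) = 0" "x + (x + (x + z)) = z" for x z :: 'm
  using char3[of x] by (simp_all add: add.assoc[symmetric])

lemma minus_eq_double: "- x = x + x" for x :: 'm
  using char3[of x] by (simp add: eq_neg_iff_add_eq_0 neg_eq_iff_add_eq_0 add.assoc)

text \<open>The cube of \<open>v y + s y t\<close> is zero: \<open>(v y)^3\<close> and
  \<open>t^3\<close> vanish, and the mixed terms have coefficient 3.\<close>

sublocale X: graded_operators v3 gr3
proof
  fix y z k and x x' :: "'m \<times> 'm \<times> 'm"
  show "v3 y (x + x') = v3 y x + v3 y x'"
    by (cases x; cases x') (simp add: v3_def v_add s_add algebra_simps)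
  show "v3 y (v3 z x) = v3 z (v3 y x)"
    by (cases x) (simp add: v3_def v_add s_add v_comm s_comm s_v algebra_simps)
  show "v3 y (v3 y (v3 y x)) = 0"
    by (cases x) (simp add: v3_def v_add s_add v_cube s_v algebra_simps char3' zero_prod_def)
  show "gr3 k 0" by (simp add: gr3_def zero_prod_def gr_zero)
  show "gr3 k x \<Longrightarrow> gr3 k x' \<Longrightarrow> gr3 k (x - x')"
    by (cases x; cases x') (simp add: gr3_def gr_diff)
  obtain x0 x1 x2 where x: "x = (x0, x1, x2)" by (cases x)
  assume "gr3 k x"
  then have g: "gr k x0" "gr (k - 1) x1" "gr (k - 2) x2" by (simp_all add: x gr3_def)
  have "gr k (s y x0 + v y x1)"
    using gr_add[OF gr_s[OF g(1)] gr_v[OF g(2), simplified]] .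
  moreover have "gr (k - 1) (s y x1 + v y x2)"
    using gr_add[OF gr_s[OF g(2), of y], of "v y x2"] gr_v[OF g(3), of y] by (simp add: algebra_simps)
  ultimately show "gr3 (k + 1) (v3 y x)"
    using gr_v[OF g(1)] by (simp add: x gr3_def v3_def algebra_simps)
qed

text \<open>The action of the combination of \<open>y\<close> and \<open>h\<close> from which
  \<open>t\<close> cancels.\<close>

definition pivoted :: "'i \<Rightarrow> 'm \<Rightarrow> 'm" where
  "pivoted y x = v y x - s y (v h x)"

text \<open>Multiplication by \<open>h\<close> on \<open>N[t]/(t^3)\<close> is \<open>t + v h\<close>, a free action of \<open>K[h]/(h^3)\<close> in characteristic 3.
  Its kernel consists of the elements \<open>(t + v h)^2 f\<close>, and on it \<open>t\<close> acts as \<open>- v h\<close>.\<close>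

lemma vanishes_cubic_extension:
  assumes "cohomology_vanishes pivoted gr ys j (d - 2)"
  shows "cohomology_vanishes v3 gr3 (h # ys) j d"
\<comment> \<open>An element killed by \<open>h\<close> is determined by its coefficient of
  \<open>t^2\<close>, and \<open>h^2\<close> sends the constant \<open>x2\<close> to an element with
  that coefficient. The preimage \<rho> under \<open>h\<close> is found by solving from the top
  coefficient downwards, taking its own top coefficient to be 0.\<close>
proof (rule X.vanishes_Cons[where \<tau> = "\<lambda>(x0, x1, x2). (x2, 0, 0)" and \<rho> = "\<lambda>(x0, x1, x2). (x1 - v h x2, x2, 0)"])
  fix k and x :: "'m \<times> 'm \<times> 'm"
  obtain x0 x1 x2 where x: "x = (x0, x1, x2)" by (cases x)
  assume g: "gr3 k x"
  {
    assume "v3 h x = 0"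
    then have 1: "v h x0 = 0" "x0 + v h x1 = 0" "x1 + v h x2 = 0"
      by (simp_all add: x v3_def s_h zero_prod_def)
    from 1 have x1: "x1 = - v h x2" by (simp add: eq_neg_iff_add_eq_0)
    with 1 have x0: "x0 = v h (v h x2)" by (simp add: v_minus)
    show "v3 h (v3 h (case x of (x0, x1, x2) \<Rightarrow> (x2, 0, 0))) = x \<and> gr3 (k - 2) (case x of (x0, x1, x2) \<Rightarrow> (x2, 0, 0))"
      using g by (simp add: x x0 x1 v3_def s_h gr3_def gr_zero v_minus minus_eq_double[symmetric])
  next
    assume "v3 h (v3 h x) = 0"
    then have "x0 + v h x1 + (v h x1 + v h (v h x2)) = 0"
      by (simp add: x v3_def s_h zero_prod_def v_add)
    then have "x0 + (v h x1 + v h x1) + v h (v h x2) = 0" by (simp only: add.assoc)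
    then have x0: "x0 = v h x1 - v h (v h x2)"
      by (simp only: minus_eq_double[symmetric]) (simp add: algebra_simps eq_neg_iff_add_eq_0)
    have "gr (k - 1) (v h x2)" using g gr_v[of "k - 2" x2 h] by (simp add: gr3_def x)
    then show "v3 h (case x of (x0, x1, x2) \<Rightarrow> (x1 - v h x2, x2, 0)) = x \<and> gr3 (k - 1) (case x of (x0, x1, x2) \<Rightarrow> (x1 - v h x2, x2, 0))"
      using g by (simp add: x x0 v3_def s_h gr3_def gr_zero v_diff gr_diff)
  }
next
  \<comment> \<open>The coefficients of \<open>(t + v h)^2 f\<close>, where 2 = -1. The factor has
    degree 2, whence the shift to \<open>d - 2\<close>.\<close>
  define \<psi> where "\<psi> f = (v h (v h f), - v h f, f)" for f
  have \<psi>_add: "\<psi> (f + f') = \<psi> f + \<psi> f'" for f f' by (simp add: \<psi>_def v_add)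
  have \<psi>_v: "\<psi> (pivoted y f) = v3 y (\<psi> f)" for y f
    by (simp add: \<psi>_def v3_def pivoted_def v_add v_diff v_minus s_minus v_comm s_v v_cube)
  have nat: "coboundary v3 ys (\<lambda>a. \<psi> (f a)) a = \<psi> (coboundary pivoted ys f a)" for f a
    using coboundary_natural[of \<psi> ys pivoted v3 f a] \<psi>_add \<psi>_v by simp
  fix c assume c: "\<forall>a\<in>indices ys j. gr3 (d + wt a) (c a) \<and> v3 h (c a) = 0"
    and cz: "\<forall>a\<in>indices ys (Suc j). coboundary v3 ys c a = 0"
  define f where "f a = snd (snd (c a))" for a
  have cf: "c a = \<psi> (f a)" if "a \<in> indices ys j" for a
  proof (cases "c a")
    case (fields x0 x1 x2)
    have "v3 h (c a) = 0" using c that by blast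
    then have "x0 + v h x1 = 0" "x1 + v h x2 = 0"
      by (simp_all add: fields v3_def s_h zero_prod_def)
    then have "x1 = - v h x2" "x0 = - v h x1" by (simp_all add: eq_neg_iff_add_eq_0)
    then show ?thesis by (simp add: fields f_def \<psi>_def v_minus)
  qed
  have gf: "gr (d - 2 + wt a) (f a)" if "a \<in> indices ys j" for a
    using c[rule_format, OF that] by (simp add: gr3_def f_def case_prod_unfold algebra_simps)
  have "coboundary pivoted ys f a = 0" if a: "a \<in> indices ys (Suc j)" for a
  proof -
    have "coboundary v3 ys c a = coboundary v3 ys (\<lambda>a. \<psi> (f a)) a"
      by (rule coboundary_cong, rule cf) (use a in \<open>auto simp: indices_def\<close>)
    then show ?thesis using cz a nat[of f a] by (simp add: \<psi>_def zero_prod_def)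
  qed
  with gf have "\<exists>b. (\<forall>a. length a = length ys \<longrightarrow> Suc (sum_list a) = j \<longrightarrow> gr (d - 2 + wt a) (b a)) \<and>
      (\<forall>a\<in>indices ys j. f a = coboundary pivoted ys b a)"
    by (intro assms[unfolded cohomology_vanishes_def, rule_format]) auto
  then obtain b where b: "\<And>a. length a = length ys \<Longrightarrow> Suc (sum_list a) = j \<Longrightarrow> gr (d - 2 + wt a) (b a)"
      "\<And>a. a \<in> indices ys j \<Longrightarrow> f a = coboundary pivoted ys b a"
    by blast
  show "\<exists>b. (\<forall>a. length a = length ys \<longrightarrow> Suc (sum_list a) = j \<longrightarrow> gr3 (d + wt a) (b a) \<and> v3 h (b a) = 0) \<and>
            (\<forall>a\<in>indices ys j. c a = coboundary v3 ys b a)"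
  proof (intro exI[of _ "\<lambda>a. \<psi> (b a)"] conjI allI impI ballI)
    fix a assume "length a = length ys" "Suc (sum_list a) = j"
    from b(1)[OF this] have g: "gr (d + wt a - 2) (b a)" by (simp add: algebra_simps)
    show "gr3 (d + wt a) (\<psi> (b a))"
      using g gr_v[OF g, of h] gr_v[OF gr_v[OF g, of h], of h] by (simp add: gr3_def \<psi>_def gr_minus)
    show "v3 h (\<psi> (b a)) = 0"
      by (simp add: \<psi>_def v3_def s_h v_cube v_minus zero_prod_def)
  next
    fix a assume "a \<in> indices ys j"
    then show "c a = coboundary v3 ys (\<lambda>a. \<psi> (b a)) a" using cf b(2) nat by simp
  qed
qed

text \<open>Long exact sequence of \<open>0 \<rightarrow> N \<rightarrow> N[t]/(t^3) \<rightarrow> N[t]/(t^2) \<rightarrow> 0\<close>, the first map being \<open>t^2\<close>.\<close>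

lemma vanishes_quadratic_extension:
  assumes "cohomology_vanishes pivoted gr ys j (d - 2)" and "cohomology_vanishes v gr (h # ys) (Suc j) (d - 2)"
  shows "cohomology_vanishes v2 gr2 (h # ys) j d"
  unfolding cohomology_vanishes_def
proof (intro allI impI)
  let ?ys = "h # ys"
  define \<pi> where "\<pi> = (\<lambda>(x0, x1, x2 :: 'm). (x0, x1) :: 'm \<times> 'm)"
  define \<iota> where "\<iota> f = (0 :: 'm, 0 :: 'm, f)" for f :: 'm
  have nat\<pi>: "coboundary v2 ?ys (\<lambda>a. \<pi> (c a)) a = \<pi> (coboundary v3 ?ys c a)"
    for a and c :: "nat list \<Rightarrow> 'm \<times> 'm \<times> 'm"
    using coboundary_natural[of \<pi> ?ys v3 v2 c a] by (auto simp: \<pi>_def v2_def v3_def)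
  have nat\<iota>: "coboundary v3 ?ys (\<lambda>a. \<iota> (f a)) a = \<iota> (coboundary v ?ys f a)" for f a
    using coboundary_natural[of \<iota> ?ys v v3 f a] by (auto simp: \<iota>_def v3_def)
  fix c assume c: "\<forall>a\<in>indices ?ys j. gr2 (d + wt a) (c a)" and cz: "\<forall>a\<in>indices ?ys (Suc j). coboundary v2 ?ys c a = 0"
  define c3 where "c3 a = (fst (c a), snd (c a), 0 :: 'm)" for a
  have \<pi>c3: "(\<lambda>a. \<pi> (c3 a)) = c" by (simp add: c3_def \<pi>_def)
  have gc3: "gr3 (d + wt a) (c3 a)" if "a \<in> indices ?ys j" for a
    using c[rule_format, OF that] by (simp add: c3_def gr2_def gr3_def gr_zero case_prod_unfold)
  \<comment> \<open>The connecting homomorphism: modulo \<open>t^2\<close> the lift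
    \<open>c3\<close> is a cocycle, so its coboundary is \<open>t^2\<close> times a cocycle \<beta>
    of the original module. Subtracting a primitive of \<beta> turns the lift into a
    cocycle.\<close>
  define \<beta> where "\<beta> a = snd (snd (coboundary v3 ?ys c3 a))" for a
  have \<beta>: "coboundary v3 ?ys c3 a = \<iota> (\<beta> a)" if "a \<in> indices ?ys (Suc j)" for a
    using cz that nat\<pi>[of c3 a] unfolding \<pi>c3
    by (auto simp: \<beta>_def \<iota>_def \<pi>_def zero_prod_def simp del: coboundary.simps split: prod.splits)
  have "\<exists>b. (\<forall>a. length a = length ?ys \<longrightarrow> Suc (sum_list a) = Suc j \<longrightarrow> gr (d - 2 + wt a) (b a)) \<and>
      (\<forall>a\<in>indices ?ys (Suc j). \<beta> a = coboundary v ?ys b a)"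
  proof (intro assms(2)[unfolded cohomology_vanishes_def, rule_format])
    fix a assume a: "a \<in> indices ?ys (Suc j)"
    have "gr3 (d + wt a) (coboundary v3 ?ys c3 a)"
      by (rule X.gr_coboundary, rule gc3) (use a in \<open>auto simp: indices_def\<close>)
    then show "gr (d - 2 + wt a) (\<beta> a)"
      by (simp add: gr3_def \<beta>_def case_prod_unfold algebra_simps del: coboundary.simps)
  next
    fix a assume a: "a \<in> indices ?ys (Suc (Suc j))"
    have "coboundary v3 ?ys (coboundary v3 ?ys c3) a = coboundary v3 ?ys (\<lambda>a. \<iota> (\<beta> a)) a"
      by (rule coboundary_cong, rule \<beta>) (use a in \<open>auto simp: indices_def\<close>)
    then show "coboundary v ?ys \<beta> a = 0"
      unfolding X.coboundary_coboundary nat\<iota> by (simp add: \<iota>_def zero_prod_def del: coboundary.simps)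
  qed
  then obtain b where b: "\<And>a. a \<in> indices ?ys j \<Longrightarrow> gr (d - 2 + wt a) (b a)"
      "\<And>a. a \<in> indices ?ys (Suc j) \<Longrightarrow> \<beta> a = coboundary v ?ys b a"
    by (auto simp: indices_def simp del: coboundary.simps)
  have "\<exists>b'. (\<forall>a. length a = length ?ys \<longrightarrow> Suc (sum_list a) = j \<longrightarrow> gr3 (d + wt a) (b' a)) \<and>
      (\<forall>a\<in>indices ?ys j. c3 a - \<iota> (b a) = coboundary v3 ?ys b' a)"
  proof (intro vanishes_cubic_extension[OF assms(1), unfolded cohomology_vanishes_def, rule_format])
    fix a assume a: "a \<in> indices ?ys j"
    have "gr3 (d + wt a) (\<iota> (b a))"
      using b(1)[OF a] by (simp add: \<iota>_def gr3_def gr_zero algebra_simps)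
    then show "gr3 (d + wt a) (c3 a - \<iota> (b a))" using gc3[OF a] by (rule X.gr_diff[rotated])
  next
    fix a assume a: "a \<in> indices ?ys (Suc j)"
    show "coboundary v3 ?ys (\<lambda>a. c3 a - \<iota> (b a)) a = 0"
      unfolding X.coboundary_diff nat\<iota> using \<beta>[OF a] b(2)[OF a] by simp
  qed
  then obtain b' where b': "\<And>a. length a = length ?ys \<Longrightarrow> Suc (sum_list a) = j \<Longrightarrow> gr3 (d + wt a) (b' a)"
      "\<And>a. a \<in> indices ?ys j \<Longrightarrow> c3 a - \<iota> (b a) = coboundary v3 ?ys b' a"
    by blast
  show "\<exists>b. (\<forall>a. length a = length ?ys \<longrightarrow> Suc (sum_list a) = j \<longrightarrow> gr2 (d + wt a) (b a)) \<and>
      (\<forall>a\<in>indices ?ys j. c a = coboundary v2 ?ys b a)"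
  proof (intro exI[of _ "\<lambda>a. \<pi> (b' a)"] conjI allI impI ballI)
    fix a assume "length a = length ?ys" "Suc (sum_list a) = j"
    from b'(1)[OF this] show "gr2 (d + wt a) (\<pi> (b' a))"
      by (simp add: gr2_def gr3_def \<pi>_def case_prod_unfold)
  next
    fix a assume a: "a \<in> indices ?ys j"
    have "c a = \<pi> (c3 a - \<iota> (b a))" by (simp add: c3_def \<pi>_def \<iota>_def)
    then show "c a = coboundary v2 ?ys (\<lambda>a. \<pi> (b' a)) a" unfolding nat\<pi> b'(2)[OF a] .
  qed
qed

end

section \<open>Direct sums and retracts\<close>

text \<open>Meant for a column at which all forms vanish: its variable contributes a second copy of
  the module, shifted by one degree.\<close>

lemma vanishes_pair:
  assumes "cohomology_vanishes v gr ys j d" and "cohomology_vanishes v gr ys j (d - 1)"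
  shows "cohomology_vanishes (\<lambda>y (x0, x1). (v y x0, v y x1)) (\<lambda>k (x0, x1). gr k x0 \<and> gr (k - 1) x1) ys j d"
    (is "cohomology_vanishes ?v ?gr ys j d")
  unfolding cohomology_vanishes_def
proof (intro allI impI)
  have "coboundary v ys (\<lambda>a. fst (c a)) a = fst (coboundary ?v ys c a)" "coboundary v ys (\<lambda>a. snd (c a)) a = snd (coboundary ?v ys c a)" for c a
    by (rule coboundary_natural; simp add: case_prod_unfold)+
  then have nat: "coboundary ?v ys c a = (coboundary v ys (\<lambda>a. fst (c a)) a, coboundary v ys (\<lambda>a. snd (c a)) a)" for c a
    by (simp only: prod.collapse)
  fix c assume c: "\<forall>a\<in>indices ys j. ?gr (d + wt a) (c a)" and cz: "\<forall>a\<in>indices ys (Suc j). coboundary ?v ys c a = 0"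
  have c': "gr (d + wt a) (fst (c a))" "gr (d - 1 + wt a) (snd (c a))" if "a \<in> indices ys j" for a
    using c[rule_format, OF that] by (simp_all add: case_prod_unfold algebra_simps)
  have cz': "coboundary v ys (\<lambda>a. fst (c a)) a = 0" "coboundary v ys (\<lambda>a. snd (c a)) a = 0" if "a \<in> indices ys (Suc j)" for a
    using cz that unfolding nat zero_prod_def by auto
  have "\<exists>b. (\<forall>a. length a = length ys \<longrightarrow> Suc (sum_list a) = j \<longrightarrow> gr (d + wt a) (b a)) \<and>
      (\<forall>a\<in>indices ys j. fst (c a) = coboundary v ys b a)"
    by (rule assms(1)[unfolded cohomology_vanishes_def, rule_format]; fact c' cz')
  then obtain b where b: "\<forall>a. length a = length ys \<longrightarrow> Suc (sum_list a) = j \<longrightarrow> gr (d + wt a) (b a)"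
      "\<forall>a\<in>indices ys j. fst (c a) = coboundary v ys b a" by blast
  have "\<exists>b. (\<forall>a. length a = length ys \<longrightarrow> Suc (sum_list a) = j \<longrightarrow> gr (d - 1 + wt a) (b a)) \<and>
      (\<forall>a\<in>indices ys j. snd (c a) = coboundary v ys b a)"
    by (rule assms(2)[unfolded cohomology_vanishes_def, rule_format]; fact c' cz')
  then obtain b' where b': "\<forall>a. length a = length ys \<longrightarrow> Suc (sum_list a) = j \<longrightarrow> gr (d - 1 + wt a) (b' a)"
      "\<forall>a\<in>indices ys j. snd (c a) = coboundary v ys b' a" by blast
  show "\<exists>b. (\<forall>a. length a = length ys \<longrightarrow> Suc (sum_list a) = j \<longrightarrow> ?gr (d + wt a) (b a)) \<and>
      (\<forall>a\<in>indices ys j. c a = coboundary ?v ys b a)"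
  proof (intro exI[of _ "\<lambda>a. (b a, b' a)"] conjI allI impI ballI)
    fix a assume "length a = length ys" "Suc (sum_list a) = j"
    then show "?gr (d + wt a) (b a, b' a)" using b(1) b'(1) by (simp add: algebra_simps)
  next
    fix a assume "a \<in> indices ys j"
    then have "fst (c a) = coboundary v ys b a" "snd (c a) = coboundary v ys b' a" using b(2) b'(2) by blast+
    then show "c a = coboundary ?v ys (\<lambda>a. (b a, b' a)) a" unfolding nat prod_eq_iff by simp
  qed
qed

text \<open>The cohomology of a retract embeds into that of the larger module: map a cocycle by
  \<phi>, bound it there, and map the primitive back by \<psi>.\<close>

lemma vanishes_retract:
  assumes vanish: "cohomology_vanishes w gr' ys j d"
    and \<phi>_add: "\<And>x x'. \<phi> (x + x') = \<phi> x + \<phi> x'" and \<phi>_v: "\<And>y x. y \<in> set ys \<Longrightarrow> \<phi> (v y x) = w y (\<phi> x)"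
    and \<phi>_gr: "\<And>k x. gr k x \<Longrightarrow> gr' k (\<phi> x)"
    and \<psi>_add: "\<And>x x'. \<psi> (x + x') = \<psi> x + \<psi> x'" and \<psi>_v: "\<And>y x. y \<in> set ys \<Longrightarrow> \<psi> (w y x) = v y (\<psi> x)"
    and \<psi>_gr: "\<And>k x. gr' k x \<Longrightarrow> gr k (\<psi> x)"
    and \<psi>\<phi>: "\<And>k x. gr k x \<Longrightarrow> \<psi> (\<phi> x) = x"
  shows "cohomology_vanishes v gr ys j d"
  unfolding cohomology_vanishes_def
proof (intro allI impI)
  have \<phi>0: "\<phi> 0 = 0" using \<phi>_add[of 0 0] by simp
  fix c assume c: "\<forall>a\<in>indices ys j. gr (d + wt a) (c a)" and cz: "\<forall>a\<in>indices ys (Suc j). coboundary v ys c a = 0"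
  have "\<exists>b. (\<forall>a. length a = length ys \<longrightarrow> Suc (sum_list a) = j \<longrightarrow> gr' (d + wt a) (b a)) \<and>
      (\<forall>a\<in>indices ys j. \<phi> (c a) = coboundary w ys b a)"
  proof (intro vanish[unfolded cohomology_vanishes_def, rule_format])
    fix a assume a: "a \<in> indices ys j"
    show "gr' (d + wt a) (\<phi> (c a))" by (rule \<phi>_gr) (rule c[rule_format, OF a])
  next
    fix a assume a: "a \<in> indices ys (Suc j)"
    have "coboundary w ys (\<lambda>a. \<phi> (c a)) a = \<phi> (coboundary v ys c a)"
      using \<phi>_add \<phi>_v by (rule coboundary_natural[of \<phi>])
    then show "coboundary w ys (\<lambda>a. \<phi> (c a)) a = 0" using cz a by (simp only: \<phi>0)
  qed
  then obtain b where b: "\<forall>a. length a = length ys \<longrightarrow> Suc (sum_list a) = j \<longrightarrow> gr' (d + wt a) (b a)"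
      "\<forall>a\<in>indices ys j. \<phi> (c a) = coboundary w ys b a" by blast
  show "\<exists>b. (\<forall>a. length a = length ys \<longrightarrow> Suc (sum_list a) = j \<longrightarrow> gr (d + wt a) (b a)) \<and>
      (\<forall>a\<in>indices ys j. c a = coboundary v ys b a)"
  proof (intro exI[of _ "\<lambda>a. \<psi> (b a)"] conjI allI impI ballI)
    fix a assume a: "a \<in> indices ys j"
    have "coboundary v ys (\<lambda>a. \<psi> (b a)) a = \<psi> (coboundary w ys b a)"
      using \<psi>_add \<psi>_v by (rule coboundary_natural[of \<psi>])
    also have "\<dots> = \<psi> (\<phi> (c a))" using a b(2) by simp
    also have "\<dots> = c a" by (rule \<psi>\<phi>) (rule c[rule_format, OF a])
    finally show "c a = coboundary v ys (\<lambda>a. \<psi> (b a)) a" ..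
  next
    fix a assume "length a = length ys" "Suc (sum_list a) = j"
    then show "gr (d + wt a) (\<psi> (b a))" using b(1) by (intro \<psi>_gr) simp
  qed
qed

section \<open>Linear forms on a squarefree algebra\<close>

text \<open>Elements of \<open>K[t_e | e \<in> E]/(t_e^2)\<close> are represented by their coefficient functions on subsets of \<open>E\<close>.\<close>

definition var_mult :: "nat \<Rightarrow> (nat set \<Rightarrow> 'a::field) \<Rightarrow> nat set \<Rightarrow> 'a" where
  "var_mult e f K = (if e \<in> K then f (K - {e}) else 0)"

text \<open>Since the sum runs over \<open>E\<close>, deleting a column shrinks \<open>E\<close> and
  leaves the form itself unchanged.\<close>

definition form_mult :: "nat set \<Rightarrow> (nat \<Rightarrow> 'a::field) \<Rightarrow> (nat set \<Rightarrow> 'a) \<Rightarrow> nat set \<Rightarrow> 'a" where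
  "form_mult E y f K = (\<Sum>e\<in>E. y e * var_mult e f K)"

definition homogeneous :: "nat set \<Rightarrow> int \<Rightarrow> (nat set \<Rightarrow> 'a::field) \<Rightarrow> bool" where
  "homogeneous E k f \<longleftrightarrow> (\<forall>K. f K \<noteq> 0 \<longrightarrow> K \<subseteq> E \<and> int (card K) = k)"

lemma var_mult_add: "var_mult e (f + g) = var_mult e f + var_mult e g"
  by (auto simp: var_mult_def)

lemma var_mult_comm: "var_mult e (var_mult e' f) = var_mult e' (var_mult e f)"
  by (auto simp: var_mult_def insert_commute Diff_insert2[symmetric] fun_eq_iff)

lemma var_mult_var_mult: "var_mult e (var_mult e f) = 0"
  by (auto simp: var_mult_def)

lemma var_mult_zero: "var_mult e 0 = 0"
  by (auto simp: var_mult_def)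

lemma var_mult_scale: "var_mult e (\<lambda>K. c * f K) K = c * var_mult e f K"
  by (auto simp: var_mult_def)

lemma var_mult_sum: "var_mult e (\<lambda>K. \<Sum>i\<in>A. g i K) K = (\<Sum>i\<in>A. var_mult e (g i) K)"
  by (auto simp: var_mult_def)

lemma form_mult_add: "form_mult E y (f + g) = form_mult E y f + form_mult E y g"
  by (auto simp: form_mult_def var_mult_add sum.distrib algebra_simps)

lemma form_mult_scale: "form_mult E y (\<lambda>K. c * f K) K = c * form_mult E y f K"
  by (simp add: form_mult_def var_mult_scale sum_distrib_left algebra_simps)

lemma form_mult_var_mult: "form_mult E y (var_mult e f) = var_mult e (form_mult E y f)"
  unfolding form_mult_def fun_eq_iff
  by (simp add: var_mult_sum var_mult_scale var_mult_comm[of e])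

lemma form_mult_comm: "form_mult E y (form_mult E z f) = form_mult E z (form_mult E y f)"
proof
  fix K
  have *: "form_mult E y (form_mult E z f) K = (\<Sum>e\<in>E. \<Sum>e'\<in>E. y e * z e' * var_mult e (var_mult e' f) K)" for y z
  proof -
    have "var_mult e (form_mult E z f) K = (\<Sum>e'\<in>E. z e' * var_mult e (var_mult e' f) K)" for e
      unfolding form_mult_var_mult[symmetric] form_mult_def
      by (intro sum.cong refl) (simp only: var_mult_comm[where e' = e])
    then show ?thesis
      by (simp add: form_mult_def[of E y] sum_distrib_left mult.assoc)
  qed
  show "form_mult E y (form_mult E z f) K = form_mult E z (form_mult E y f) K"
    unfolding * by (subst sum.swap) (simp add: var_mult_comm mult.commute)
qed

lemma form_mult_insert:
  "finite E \<Longrightarrow> e \<notin> E \<Longrightarrow> form_mult (insert e E) y f = form_mult E y f + (\<lambda>K. y e * var_mult e f K)"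
  by (auto simp: form_mult_def)

text \<open>A new column adds to the operator a summand \<open>t\<close> that commutes with it and
  has \<open>t^2 = 0\<close>, so the cube changes by \<open>3 v^2 t = 0\<close>.\<close>

lemma form_mult_cube:
  assumes "finite E" and three: "(3 :: 'a::field) = 0"
  shows "form_mult E y (form_mult E y (form_mult E y f)) = (0 :: nat set \<Rightarrow> 'a)"
  using assms(1)
proof (induction E arbitrary: f)
  case (insert e E)
  let ?v = "form_mult E y"
  define t where "t f = (\<lambda>K. y e * var_mult e f K)" for f
  have v0: "?v 0 = 0" by (simp add: fun_eq_iff form_mult_def var_mult_zero)
  have t_add: "t (f + g) = t f + t g" for f g by (auto simp: t_def fun_eq_iff var_mult_add algebra_simps)
  have tt: "t (t f) = 0" for f
    by (auto simp: t_def fun_eq_iff var_mult_scale var_mult_var_mult)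
  have vt: "?v (t f) = t (?v f)" for f
    by (auto simp: t_def fun_eq_iff form_mult_scale form_mult_var_mult)
  have t0: "t 0 = 0" by (simp add: t_def fun_eq_iff var_mult_zero)
  have w: "form_mult (insert e E) y f = ?v f + t f" for f
    using insert by (simp add: form_mult_insert t_def)
  have "form_mult (insert e E) y (form_mult (insert e E) y (form_mult (insert e E) y f))
    = ?v (?v (?v f)) + (t (?v (?v f)) + t (?v (?v f)) + t (?v (?v f)))"
    by (simp only: w form_mult_add t_add tt vt v0 t0 add_0_left add_0_right add.assoc)
  also have "\<dots> = 0"
  proof -
    have three': "x + x + x = 0" for x :: 'a
    proof -
      have "x + x + x = 3 * x" by simp
      also have "\<dots> = 0" using three by (simp only: mult_zero_left)
      finally show ?thesis .
    qed
    have "g + g + g = 0" for g :: "nat set \<Rightarrow> 'a"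
      by (rule ext) (simp only: plus_fun_apply zero_fun_apply three')
    then show ?thesis by (simp only: insert.IH add_0_left)
  qed
  finally show ?case .
qed (auto simp: form_mult_def)

lemma homogeneous_form_mult:
  assumes "finite E" "homogeneous E k f"
  shows "homogeneous E (k + 1) (form_mult E y f)"
  unfolding homogeneous_def
proof (intro allI impI)
  fix K assume "form_mult E y f K \<noteq> 0"
  then obtain e where e: "e \<in> E" "y e * var_mult e f K \<noteq> 0"
    unfolding form_mult_def by (rule sum.not_neutral_contains_not_neutral)
  then have K: "e \<in> K" "f (K - {e}) \<noteq> 0" by (auto simp: var_mult_def split: if_splits)
  then have 1: "K - {e} \<subseteq> E" "int (card (K - {e})) = k"
    using assms(2) unfolding homogeneous_def by blast+
  from 1(1) e(1) have "K \<subseteq> E" by blast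
  moreover from this have "card K = Suc (card (K - {e}))"
    using K(1) assms(1) by (intro card.remove) (auto dest: finite_subset)
  ultimately show "K \<subseteq> E \<and> int (card K) = k + 1" using 1(2) by simp
qed

lemma graded_operators_form_mult:
  assumes "finite E" and "(3 :: 'a::field) = 0"
  shows "graded_operators (form_mult E :: (nat \<Rightarrow> 'a) \<Rightarrow> _) (homogeneous E)"
proof
  fix k and x x' :: "nat set \<Rightarrow> 'a"
  show "homogeneous E k 0" by (simp add: homogeneous_def)
  assume x: "homogeneous E k x" and x': "homogeneous E k x'"
  show "homogeneous E k (x - x')"
    unfolding homogeneous_def
  proof (intro allI impI)
    fix K assume "(x - x') K \<noteq> 0"
    then have "x K \<noteq> 0 \<or> x' K \<noteq> 0" by auto
    then show "K \<subseteq> E \<and> int (card K) = k" using x x' unfolding homogeneous_def by blast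
  qed
qed (simp_all add: assms form_mult_add form_mult_comm form_mult_cube homogeneous_form_mult)

text \<open>Splitting coefficient functions by whether \<open>e \<in> K\<close> gives the expansion
  in powers of \<open>t = \<alpha> t_e\<close>. The factor \<alpha> leaves room to normalise the
  coefficient of one form to 1.\<close>

lemma vanishes_insert:
  assumes E: "finite E" "e \<notin> E" and \<alpha>: "\<alpha> \<noteq> 0"
    and vanish: "cohomology_vanishes (\<lambda>y (x0, x1). (form_mult E y x0, (\<lambda>K. y e / \<alpha> * x0 K) + form_mult E y x1))
      (\<lambda>k (x0, x1). homogeneous E k x0 \<and> homogeneous E (k - 1) x1) ys j d"
  shows "cohomology_vanishes (form_mult (insert e E)) (homogeneous (insert e E)) ys j d"
proof (rule vanishes_retract[OF vanish])
  let ?\<phi> = "\<lambda>f. (\<lambda>K. if e \<in> K then 0 else f K, \<lambda>K. if e \<in> K then 0 else f (insert e K) / \<alpha>)"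
  let ?\<psi> = "\<lambda>(x0, x1). x0 + (\<lambda>K. \<alpha> * var_mult e x1 K)"
  fix y k x x'
  show "?\<phi> (x + x') = ?\<phi> x + ?\<phi> x'"
    by (auto simp: add_divide_distrib)
  show "?\<phi> (form_mult (insert e E) y x) =
      (case ?\<phi> x of (x0, x1) \<Rightarrow> (form_mult E y x0, (\<lambda>K. y e / \<alpha> * x0 K) + form_mult E y x1))"
  proof -
    have 1: "form_mult E y x K = form_mult E y (\<lambda>K. if e \<in> K then 0 else x K) K" if "e \<notin> K" for K
      using that E by (auto simp: form_mult_def var_mult_def intro!: sum.cong)
    have 2: "form_mult E y (\<lambda>K. if e \<in> K then 0 else g K) K = 0" if "e \<in> K" for K and g :: "nat set \<Rightarrow> 'a"
      unfolding form_mult_def using that E(2) by (intro sum.neutral) (auto simp: var_mult_def)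
    have 3: "form_mult E y x (insert e K) / \<alpha> = form_mult E y (\<lambda>K. if e \<in> K then 0 else x (insert e K) / \<alpha>) K" if "e \<notin> K" for K
      unfolding form_mult_def sum_divide_distrib using that E(2)
      by (intro sum.cong) (auto simp: var_mult_def insert_Diff_if)
    show ?thesis using E
      by (auto simp: form_mult_insert fun_eq_iff 1 2 3[symmetric] var_mult_def add_divide_distrib)
  qed
  show "case ?\<phi> x of (x0, x1) \<Rightarrow> homogeneous E k x0 \<and> homogeneous E (k - 1) x1" if "homogeneous (insert e E) k x"
  proof -
    have "K \<subseteq> E \<and> int (card K) = k" if "x K \<noteq> 0" "e \<notin> K" for K
      using \<open>homogeneous (insert e E) k x\<close> that unfolding homogeneous_def by blast
    moreover have "K \<subseteq> E \<and> int (card K) = k - 1" if "x (insert e K) \<noteq> 0" "e \<notin> K" for K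
    proof -
      from \<open>homogeneous (insert e E) k x\<close> that have K: "insert e K \<subseteq> insert e E" "int (card (insert e K)) = k"
        unfolding homogeneous_def by blast+
      with that have "K \<subseteq> E" by blast
      moreover from this have "finite K" using E(1) by (rule finite_subset)
      ultimately show ?thesis using K(2) that by simp
    qed
    ultimately show ?thesis by (simp add: homogeneous_def)
  qed
  fix p p' :: "(nat set \<Rightarrow> 'a) \<times> (nat set \<Rightarrow> 'a)"
  show "?\<psi> (p + p') = ?\<psi> p + ?\<psi> p'"
    by (cases p; cases p') (simp add: var_mult_add fun_eq_iff algebra_simps)
  show "?\<psi> (case p of (x0, x1) \<Rightarrow> (form_mult E y x0, (\<lambda>K. y e / \<alpha> * x0 K) + form_mult E y x1)) = form_mult (insert e E) y (?\<psi> p)"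
    using E \<alpha> 
    by (cases p) (auto simp: form_mult_insert form_mult_add var_mult_add fun_eq_iff form_mult_scale var_mult_scale
        var_mult_var_mult form_mult_var_mult algebra_simps, simp add: var_mult_def)
  show "homogeneous (insert e E) k (?\<psi> p)" if "case p of (x0, x1) \<Rightarrow> homogeneous E k x0 \<and> homogeneous E (k - 1) x1"
  proof (cases p)
    case (Pair x0 x1)
    with that have x0: "homogeneous E k x0" and x1: "homogeneous E (k - 1) x1" by simp_all
    show ?thesis
      unfolding homogeneous_def
    proof (intro allI impI)
      fix K assume "(?\<psi> p) K \<noteq> 0"
      then consider "x0 K \<noteq> 0" | "e \<in> K" "x1 (K - {e}) \<noteq> 0"
        by (fastforce simp: Pair var_mult_def split: if_splits)
      then show "K \<subseteq> insert e E \<and> int (card K) = k"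
      proof cases
        case 1
        then show ?thesis using x0 unfolding homogeneous_def by blast
      next
        case 2
        then have K: "K - {e} \<subseteq> E" "int (card (K - {e})) = k - 1"
          using x1 unfolding homogeneous_def by blast+
        then have "finite K" using E(1) by (metis finite_Diff2 finite.emptyI finite_insert finite_subset)
        then have "card K = Suc (card (K - {e}))" using 2(1) by (rule card.remove)
        then show ?thesis using K by auto
      qed
    qed
  qed
  show "homogeneous (insert e E) k x \<Longrightarrow> ?\<psi> (?\<phi> x) = x"
    using \<alpha> by (auto simp: var_mult_def fun_eq_iff insert_absorb)
qed

section \<open>Independent linear forms and elimination\<close>

definition independent_on :: "nat set \<Rightarrow> (nat \<Rightarrow> 'a::field) list \<Rightarrow> bool" where
  "independent_on B ys \<longleftrightarrow> (\<forall>cs. length cs = length ys \<longrightarrow> (\<forall>e\<in>B. (\<Sum>(c, y)\<leftarrow>zip cs ys. c * y e) = 0) \<longrightarrow> (\<forall>c\<in>set cs. c = 0))"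

lemma independent_onD:
  assumes "independent_on B ys" "length cs = length ys" "\<And>e. e \<in> B \<Longrightarrow> (\<Sum>(c, y)\<leftarrow>zip cs ys. c * y e) = 0"
  shows "c \<in> set cs \<Longrightarrow> c = 0"
  using assms unfolding independent_on_def by blast

definition pivot :: "nat \<Rightarrow> (nat \<Rightarrow> 'a::field) \<Rightarrow> (nat \<Rightarrow> 'a) \<Rightarrow> nat \<Rightarrow> 'a" where
  "pivot e h y = (\<lambda>i. y i - y e / h e * h i)"

lemma independent_on_move_to_front:
  assumes "independent_on B (pre @ h # post)"
  shows "independent_on B (h # pre @ post)"
  unfolding independent_on_def
proof (intro allI impI)
  fix cs assume len: "length cs = length (h # pre @ post)"
    and 0: "\<forall>e\<in>B. (\<Sum>(c, y)\<leftarrow>zip cs (h # pre @ post). c * y e) = 0"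
  obtain c cs' where cs: "cs = c # cs'" using len by (cases cs) auto
  define as bs where "as = take (length pre) cs'" and "bs = drop (length pre) cs'"
  have cs': "cs' = as @ bs" and l: "length as = length pre" "length bs = length post"
    using len by (auto simp: as_def bs_def cs)
  have "x = 0" if "x \<in> set (as @ c # bs)" for x
    by (rule independent_onD[OF assms _ _ that])
      (use 0 l in \<open>simp_all add: cs cs' algebra_simps\<close>)
  then show "\<forall>x\<in>set cs. x = 0" by (auto simp: cs cs')
qed

text \<open>Collecting the multiples of \<open>h\<close> turns a relation between the pivoted forms
  into one between \<open>h\<close> and the original forms, with the same coefficients on the
  latter.\<close>

lemma independent_on_pivot:
  assumes "independent_on B (h # ys)"
  shows "independent_on B (map (pivot e h) ys)"
  unfolding independent_on_def
proof (intro allI impI)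
  fix cs assume len: "length cs = length (map (pivot e h) ys)"
    and 0: "\<forall>i\<in>B. (\<Sum>(c, y)\<leftarrow>zip cs (map (pivot e h) ys). c * y i) = 0"
  have *: "(\<Sum>(c, y)\<leftarrow>zip cs (map (pivot e h) ys). c * y i)
     = (\<Sum>(c, y)\<leftarrow>zip cs ys. c * y i) - (\<Sum>(c, y)\<leftarrow>zip cs ys. c * (y e / h e)) * h i" for i
    using len by (induction cs ys rule: list_induct2') (auto simp: pivot_def algebra_simps)
  have "x = 0" if "x \<in> set (- (\<Sum>(c, y)\<leftarrow>zip cs ys. c * (y e / h e)) # cs)" for x
  proof (rule independent_onD[OF assms _ _ that])
    fix i assume "i \<in> B"
    with 0 show "(\<Sum>(c, y)\<leftarrow>zip (- (\<Sum>(c, y)\<leftarrow>zip cs ys. c * (y e / h e)) # cs) (h # ys). c * y i) = 0"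
      unfolding * by simp
  qed (use len in simp)
  then show "\<forall>x\<in>set cs. x = 0" by simp
qed

definition support :: "(nat \<Rightarrow> 'a::field) list \<Rightarrow> nat set" where
  "support ys = {e. \<exists>y\<in>set ys. y e \<noteq> 0}"

lemma support_pivot:
  assumes "h e \<noteq> 0"
  shows "support (map (pivot e h) ys) \<subseteq> support (h # ys) - {e}"
  using assms by (auto simp: support_def pivot_def)

text \<open>Gaussian elimination: each pivot uses up one form and at least one element of the
  support in \<open>B\<close>.\<close>

lemma length_le_card_support:
  assumes "finite B" and "independent_on B ys"
  shows "length ys \<le> card (B \<inter> support ys)"
  using assms(2)
proof (induction "length ys" arbitrary: ys)
  case (Suc n)
  \<comment> \<open>If all forms vanished on \<open>B\<close>, the relation with all coefficients 1
    would contradict independence.\<close>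
  have "\<exists>e\<in>B. \<exists>y\<in>set ys. y e \<noteq> 0"
  proof (rule ccontr)
    assume "\<not> ?thesis"
    then have "map (\<lambda>(c, y). c * y e) (zip (replicate (length ys) (1::'a)) ys) = map (\<lambda>_. 0) (zip (replicate (length ys) (1::'a)) ys)"
      if "e \<in> B" for e
      using that by (intro map_cong) (auto dest: set_zip_rightD)
    then have "c = 0" if "c \<in> set (replicate (length ys) (1::'a))" for c
      using independent_onD[OF Suc.prems _ _ that] by (simp add: map_replicate_const sum_list_replicate)
    from this[of 1] show False using Suc.hyps(2) by (cases ys) auto
  qed
  then obtain e h pre post where e: "e \<in> B" "h e \<noteq> 0" and ys: "ys = pre @ h # post"
    by (metis split_list)
  let ?zs = "map (pivot e h) (pre @ post)"
  have "independent_on B ?zs"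
    using independent_on_pivot[OF independent_on_move_to_front[OF Suc.prems[unfolded ys]]] .
  then have "length ?zs \<le> card (B \<inter> support ?zs)"
    using Suc.hyps(1)[of ?zs] Suc.hyps(2) ys by simp
  also have "\<dots> \<le> card (B \<inter> support ys - {e})"
  proof (rule card_mono)
    have "support (h # pre @ post) = support ys" by (auto simp: ys support_def)
    then show "B \<inter> support ?zs \<subseteq> B \<inter> support ys - {e}"
      using support_pivot[of h e "pre @ post"] e(2) by blast
  qed (use assms(1) in simp)
  also have "Suc \<dots> = card (B \<inter> support ys)"
    using e assms(1) by (intro card_Suc_Diff1) (auto simp: ys support_def)
  finally show ?case by (simp add: ys)
qed simp

text \<open>Induction on \<open>E\<close>. For \<open>h e \<noteq> 0\<close> the long exact sequence reduces the claim to a contraction of \<open>e\<close> (one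
  form less) and a deletion of \<open>e\<close> (the support outside of \<open>E\<close> grows by one), both with \<open>d\<close> lowered by 2; the
  inequality is preserved in either case. For \<open>E = {}\<close> it contradicts the degrees of nonzero cochains.\<close>

lemma vanishes_form_mult:
  fixes ys :: "(nat \<Rightarrow> 'a::field) list"
  assumes three: "(3 :: 'a) = 0"
    and \<B>: "finite \<B>" "pairwise disjnt \<B>" "card \<B> \<ge> 4" "\<And>B. B \<in> \<B> \<Longrightarrow> finite B"
    and "finite E" and "\<And>B. B \<in> \<B> \<Longrightarrow> independent_on B ys"
    and "2 * d + 3 * int j + int (card (\<Union>\<B> \<inter> support ys - E)) < 4 * int (length ys)"
  shows "cohomology_vanishes (form_mult E) (homogeneous E) ys j d"
  using assms(6-8)
proof (induction E arbitrary: ys d j rule: finite_induct)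
  case empty
  have "4 * length ys \<le> (\<Sum>B\<in>\<B>. length ys)" using \<B>(3) by simp
  also have "\<dots> \<le> (\<Sum>B\<in>\<B>. card (B \<inter> support ys))"
    by (intro sum_mono length_le_card_support \<B>(4) empty.prems(1))
  also have "\<dots> = card (\<Union>B\<in>\<B>. B \<inter> support ys)"
    using \<B> by (intro card_UN_disjoint[symmetric]) (auto simp: pairwise_def disjnt_def)
  also have "(\<Union>B\<in>\<B>. B \<inter> support ys) = \<Union>\<B> \<inter> support ys" by blast
  finally have d: "2 * d + 3 * int j < 0" using empty.prems(2) by simp
  show ?case
    unfolding cohomology_vanishes_def
  proof (intro allI impI)
    fix c :: "nat list \<Rightarrow> nat set \<Rightarrow> 'a"
    assume c: "\<forall>a\<in>indices ys j. homogeneous {} (d + wt a) (c a)"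
    have "c a = 0" if "a \<in> indices ys j" for a
    proof
      fix K
      have "2 * wt a \<le> 3 * int j" using wt_le[of a] that by (simp add: indices_def)
      then have "d + wt a \<noteq> 0" using d by linarith
      then show "c a K = 0 K" using c that unfolding homogeneous_def by fastforce
    qed
    moreover have "coboundary (form_mult {}) ys (\<lambda>_. 0) a = 0" for a
      using graded_operators.coboundary_zero[OF graded_operators_form_mult[OF finite.emptyI three]] .
    ultimately show "\<exists>b. (\<forall>a. length a = length ys \<longrightarrow> Suc (sum_list a) = j \<longrightarrow> homogeneous {} (d + wt a) (b a)) \<and>
       (\<forall>a\<in>indices ys j. c a = coboundary (form_mult {}) ys b a)"
      by (intro exI[of _ "\<lambda>_. 0"]) (auto simp: homogeneous_def)
  qed
next
  case (insert e E)
  show ?case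
  proof (cases "\<forall>y\<in>set ys. y e = 0")
    \<comment> \<open>The variable of \<open>e\<close> is not involved in any form, so the module is
      two shifted copies of the one for \<open>E\<close>. The deleted part of the support does not
      change, and any \<alpha> would do; 1 is chosen.\<close>
    case True
    then have "\<Union>\<B> \<inter> support ys - insert e E = \<Union>\<B> \<inter> support ys - E" by (auto simp: support_def)
    then have *: "cohomology_vanishes (form_mult E) (homogeneous E) ys j d" "cohomology_vanishes (form_mult E) (homogeneous E) ys j (d - 1)"
      using insert.prems(2) by (auto intro!: insert.IH[OF insert.prems(1)])
    have "cohomology_vanishes (\<lambda>y (x0, x1). (form_mult E y x0, (\<lambda>K. y e / 1 * x0 K) + form_mult E y x1))
        (\<lambda>k (x0, x1). homogeneous E k x0 \<and> homogeneous E (k - 1) x1) ys j d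
      = cohomology_vanishes (\<lambda>y (x0, x1). (form_mult E y x0, form_mult E y x1))
        (\<lambda>k (x0, x1). homogeneous E k x0 \<and> homogeneous E (k - 1) x1) ys j d"
      by (rule vanishes_cong) (use True in \<open>auto simp: fun_eq_iff\<close>)
    then show ?thesis
      using vanishes_pair[OF *] vanishes_insert[OF insert.hyps, of 1] by simp
  next
    case False
    then obtain h pre post where h: "h e \<noteq> 0" and ys: "ys = pre @ h # post"
      by (metis split_list)
    let ?zs = "pre @ post"
    interpret graded_operators "form_mult (insert e E) :: (nat \<Rightarrow> 'a) \<Rightarrow> _" "homogeneous (insert e E)"
      by (rule graded_operators_form_mult) (use insert.hyps three in auto)
    interpret S: graded_operators "form_mult E :: (nat \<Rightarrow> 'a) \<Rightarrow> _" "homogeneous E"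
      by (rule graded_operators_form_mult) (use insert.hyps three in auto)
    \<comment> \<open>With \<open>t = h e * t_e\<close>, the form \<open>y\<close> has coefficient
      \<open>y e / h e\<close> at \<open>t\<close>, which is 1 for \<open>h\<close>.\<close>
    interpret S: graded_operators_scaled "form_mult E :: (nat \<Rightarrow> 'a) \<Rightarrow> _" "homogeneous E"
        "\<lambda>y f K. y e / h e * f K" h
    proof
      fix x :: "nat set \<Rightarrow> 'a"
      have "x K + x K + x K = 0" for K
      proof -
        have "x K + x K + x K = 3 * x K" by simp
        also have "\<dots> = 0" using three by (simp only: mult_zero_left)
        finally show ?thesis .
      qed
      then show "x + x + x = 0" by (simp only: fun_eq_iff plus_fun_apply zero_fun_apply simp_thms)
    qed (use h in \<open>simp_all add: fun_eq_iff homogeneous_def form_mult_scale[of _ _ "_ / _", simplified] distrib_left mult.left_commute\<close>)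
    have ind: "independent_on B (h # ?zs)" if "B \<in> \<B>" for B
      using independent_on_move_to_front insert.prems(1)[OF that] unfolding ys by blast
    have supp: "support ys = support (h # ?zs)" by (auto simp: support_def ys)
    have finU: "finite (\<Union>\<B>)" using \<B> by blast
    have len: "length ys = Suc (length ?zs)" by (simp add: ys)
    show ?thesis
      unfolding ys
    proof (rule vanishes_move_to_front, rule vanishes_insert[OF insert.hyps h])
      \<comment> \<open>Contraction: both sides of the inequality drop by 4, and the pivoted forms
        vanish at \<open>e\<close>, so the deleted support does not grow.\<close>
      have "cohomology_vanishes (form_mult E) (homogeneous E) (map (pivot e h) ?zs) j (d - 2)"
      proof (rule insert.IH)
        show "independent_on B (map (pivot e h) ?zs)" if "B \<in> \<B>" for B
          using independent_on_pivot[OF ind[OF that]] .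
        have "card (\<Union>\<B> \<inter> support (map (pivot e h) ?zs) - E) \<le> card (\<Union>\<B> \<inter> support ys - insert e E)"
          using support_pivot[of h e ?zs, OF h] finU unfolding supp by (intro card_mono) auto
        then show "2 * (d - 2) + 3 * int j + int (card (\<Union>\<B> \<inter> support (map (pivot e h) ?zs) - E))
            < 4 * int (length (map (pivot e h) ?zs))"
          using insert.prems(2) len by simp
      qed
      moreover have "form_mult E (pivot e h y) x = S.pivoted y x" for x y
        unfolding S.pivoted_def pivot_def
        by (auto simp: form_mult_def fun_eq_iff sum_subtractf sum_distrib_left algebra_simps)
      ultimately have 1: "cohomology_vanishes S.pivoted (homogeneous E) ?zs j (d - 2)"
        unfolding vanishes_map by (subst (asm) vanishes_cong)
      \<comment> \<open>Deletion: -4 from the degree, +3 from the cohomological degree and at most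
        +1 from \<open>e\<close> cancel.\<close>
      have 2: "cohomology_vanishes (form_mult E) (homogeneous E) (h # ?zs) (Suc j) (d - 2)"
      proof (rule insert.IH)
        show "independent_on B (h # ?zs)" if "B \<in> \<B>" for B using ind[OF that] .
        have "card (\<Union>\<B> \<inter> support (h # ?zs) - E) \<le> card (insert e (\<Union>\<B> \<inter> support ys - insert e E))"
          using finU unfolding supp by (intro card_mono) auto
        also have "\<dots> \<le> Suc (card (\<Union>\<B> \<inter> support ys - insert e E))" by (rule card_insert_le_m1) auto
        finally show "2 * (d - 2) + 3 * int (Suc j) + int (card (\<Union>\<B> \<inter> support (h # ?zs) - E)) < 4 * int (length (h # ?zs))"
          using insert.prems(2) len by simp
      qed
      have "cohomology_vanishes S.v2 S.gr2 (h # ?zs) j d" by (rule S.vanishes_quadratic_extension[OF 1 2])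
      then show "cohomology_vanishes (\<lambda>y (x0, x1). (form_mult E y x0, (\<lambda>K. y e / h e * x0 K) + form_mult E y x1))
          (\<lambda>k (x0, x1). homogeneous E k x0 \<and> homogeneous E (k - 1) x1) (h # ?zs) j d"
        unfolding S.v2_def S.gr2_def .
    qed
  qed
qed

section \<open>Permanents as coefficients\<close>

context graded_operators
begin

text \<open>The constant cochain \<open>f\<close> is a cocycle, and every coboundary is 0 at the
  zero index.\<close>

lemma socle_zero:
  assumes "cohomology_vanishes v gr ys 0 d" and "gr d f" and "\<And>y. y \<in> set ys \<Longrightarrow> v y f = 0"
  shows "f = 0"
proof -
  have 0: "coboundary v ys (\<lambda>_. f) a = 0" for a
    using assms(3)
  proof (induction ys arbitrary: a)
    case (Cons y ys)
    have IH: "coboundary v ys (\<lambda>_. f) a = 0" for a by (rule Cons.IH, rule Cons.prems) simp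
    show ?case by (cases a) (auto simp: IH Cons.prems split: nat.split)
  qed simp
  have wt0: "wt a = 0" if "sum_list a = 0" for a
    using that by (induction a) auto
  have "\<exists>b. (\<forall>a. length a = length ys \<longrightarrow> Suc (sum_list a) = 0 \<longrightarrow> gr (d + wt a) (b a)) \<and> (\<forall>a\<in>indices ys 0. f = coboundary v ys b a)"
  proof (rule assms(1)[unfolded cohomology_vanishes_def, rule_format])
    show "gr (d + wt a) f" if "a \<in> indices ys 0" for a
      using that assms(2) wt0 by (simp add: indices_def)
  qed (rule 0)
  then obtain b where "\<And>a. a \<in> indices ys 0 \<Longrightarrow> f = coboundary v ys b a" by blast
  from this[of "replicate (length ys) 0"] show ?thesis
    by (simp add: indices_def coboundary_zero_index sum_list_replicate)
qed

lemma fold_v_mset_eq: "mset xs = mset ys \<Longrightarrow> fold v xs = fold v ys"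
  by (rule fold_multiset_equiv) (auto simp: fun_eq_iff v_comm)

lemma gr_fold: "gr k x \<Longrightarrow> gr (k + int (length xs)) (fold v xs x)"
proof (induction xs arbitrary: k x)
  case (Cons y xs)
  from Cons.IH[OF gr_v[OF Cons.prems]] show ?case by (simp add: algebra_simps)
qed simp

lemma product_of_squares_nonzero:
  assumes x: "gr 0 x" "x \<noteq> 0"
    and vanish: "\<And>d. d < 2 * int (length ys) \<Longrightarrow> cohomology_vanishes v gr ys 0 d"
  shows "fold v (ys @ ys) x \<noteq> 0"
proof -
  let ?n = "length ys"
  \<comment> \<open>As long as the degree is below twice the number of forms, a nonzero product is
    not in the socle, so some further factor keeps it nonzero.\<close>
  have "\<exists>L. length L = k \<and> set L \<subseteq> {..<?n} \<and> fold v (map ((!) ys) L) x \<noteq> 0" if "k \<le> 2 * ?n" for k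
    using that
  proof (induction k)
    case (Suc k)
    then obtain L where L: "length L = k" "set L \<subseteq> {..<?n}" "fold v (map ((!) ys) L) x \<noteq> 0" by auto
    have "gr (int k) (fold v (map ((!) ys) L) x)"
      using gr_fold[OF x(1), of "map ((!) ys) L"] L(1) by simp
    moreover have "cohomology_vanishes v gr ys 0 (int k)" by (rule vanish) (use Suc.prems in simp)
    ultimately have "\<exists>y\<in>set ys. v y (fold v (map ((!) ys) L) x) \<noteq> 0"
      using socle_zero[of ys "int k" "fold v (map ((!) ys) L) x"] L(3) by blast
    then obtain y where "y \<in> set ys" "v y (fold v (map ((!) ys) L) x) \<noteq> 0" by (rule bexE)
    moreover from this(1) obtain i where "i < ?n" "ys ! i = y" unfolding in_set_conv_nth by (elim exE conjE)
    ultimately have "i < ?n" "v (ys ! i) (fold v (map ((!) ys) L) x) \<noteq> 0" by simp_all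
    then show ?case using L(1,2) by (intro exI[of _ "L @ [i]"]) simp
  qed (use x in auto)
  then obtain L where L: "length L = 2 * ?n" "set L \<subseteq> {..<?n}" "fold v (map ((!) ys) L) x \<noteq> 0" by blast
  have le: "count (mset L) i \<le> 2" for i
  proof (rule ccontr)
    assume "\<not> ?thesis"
    then have "replicate_mset 3 i \<subseteq># mset L"
      by (simp only: count_le_replicate_mset_subset_eq[symmetric])
    then obtain M where M: "mset L = replicate_mset 3 i + M" by (auto simp: mset_subset_eq_exists_conv)
    obtain L' where L': "mset L' = M" using ex_mset by blast
    have "mset L = mset (L' @ [i, i, i])" by (simp add: M L' numeral_3_eq_3)
    then have "mset (map ((!) ys) L) = mset (map ((!) ys) (L' @ [i, i, i]))" by (simp only: mset_map)
    from fold_v_mset_eq[OF this] have "fold v (map ((!) ys) L) x = fold v (map ((!) ys) (L' @ [i, i, i])) x"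
      by (rule fun_cong)
    also have "\<dots> = 0" by (simp add: v_cube)
    finally show False using L(3) by contradiction
  qed
  have "mset L \<subseteq># mset ([0..<?n] @ [0..<?n])"
    unfolding subseteq_mset_def
  proof
    fix i
    show "count (mset L) i \<le> count (mset ([0..<?n] @ [0..<?n])) i"
    proof (cases "i \<in> set L")
      case True
      then have "i \<in> set [0..<?n]" using L(2) by auto
      then have "count (mset [0..<?n]) i = 1"
        using distinct_count_atmost_1[THEN iffD1, OF distinct_upt, THEN spec, of 0 ?n i] by (simp only: if_True)
      then show ?thesis using le[of i] by (simp only: mset_append count_union)
    next
      case False
      then have "count (mset L) i = 0" by (simp add: count_mset_0_iff)
      then show ?thesis by (simp only: zero_le)
    qed
  qed
  \<comment> \<open>No index occurs three times, and both multisets have \<open>2 * ?n\<close>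
    elements, so every index occurs exactly twice.\<close>
  then have "mset L = mset ([0..<?n] @ [0..<?n])"
    using mset_subset_size[of "mset L" "mset ([0..<?n] @ [0..<?n])"] L(1)
    by (simp only: subset_mset.le_less size_mset length_append length_upt) linarith
  then have "mset (map ((!) ys) L) = mset (map ((!) ys) ([0..<?n] @ [0..<?n]))" by (simp only: mset_map)
  moreover have "map ((!) ys) ([0..<?n] @ [0..<?n]) = ys @ ys" by (simp add: map_nth)
  ultimately have "mset (map ((!) ys) L) = mset (ys @ ys)" by (rule back_subst)
  from fold_v_mset_eq[OF this] L(3) show ?thesis by simp
qed

end

section \<open>Coefficients of products of forms as sums over bijections\<close>

definition one_elem :: "nat set \<Rightarrow> 'a::field" where
  "one_elem K = (if K = {} then 1 else 0)"

text \<open>Extensionality fixes the values outside the rows, so that sums over this set count each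
  bijection once.\<close>

definition bijections :: "nat \<Rightarrow> nat set \<Rightarrow> (nat \<Rightarrow> nat) set" where
  "bijections m K = {f \<in> {..<m} \<rightarrow>\<^sub>E K. bij_betw f {..<m} K}"

text \<open>Expansion along the last row: first choose the column \<open>e\<close> of row
  \<open>m\<close>, then a bijection of the other rows onto the rest.\<close>

lemma sum_bijections_Suc:
  assumes "finite K"
  shows "(\<Sum>f\<in>bijections (Suc m) K. G (f m) (restrict f {..<m})) = (\<Sum>e\<in>K. \<Sum>g\<in>bijections m (K - {e}). G e g)"
proof -
  have fin: "finite (bijections m (K - {e}))" for e
    by (rule finite_subset[of _ "{..<m} \<rightarrow>\<^sub>E (K - {e})"]) (use assms in \<open>auto simp: bijections_def intro!: finite_PiE\<close>)
  show ?thesis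
    unfolding sum.Sigma[OF assms ballI[OF fin]]
  proof (rule sum.reindex_bij_witness[where i = "\<lambda>(e, g). g(m := e)" and j = "\<lambda>f. (f m, restrict f {..<m})"])
    fix f assume f: "f \<in> bijections (Suc m) K"
    then have b: "bij_betw f (insert m {..<m}) K" and ext: "f \<in> extensional {..<Suc m}"
      by (auto simp: bijections_def lessThan_Suc PiE_def)
    then have fm: "f m \<in> K" by (auto simp: bij_betw_def)
    have "bij_betw f {..<m} (K - {f m})"
      using b notIn_Un_bij_betw3[of m "{..<m}" f "K - {f m}"] fm by (auto simp: insert_absorb)
    then have "bij_betw (restrict f {..<m}) {..<m} (K - {f m})"
      by (simp add: bij_betw_restrict_eq)
    then have "restrict f {..<m} \<in> bijections m (K - {f m})"
      by (auto simp: bijections_def bij_betw_def)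
    then show "(f m, restrict f {..<m}) \<in> (SIGMA e:K. bijections m (K - {e}))" using fm by simp
    show "(case (f m, restrict f {..<m}) of (e, g) \<Rightarrow> g(m := e)) = f"
      using ext by (auto simp: fun_eq_iff extensional_def)
  next
    fix p assume "p \<in> (SIGMA e:K. bijections m (K - {e}))"
    then obtain e g where p: "p = (e, g)" "e \<in> K" and b: "bij_betw g {..<m} (K - {e})" and ext: "g \<in> extensional {..<m}"
      by (auto simp: bijections_def PiE_def)
    have "bij_betw (g(m := e)) {..<m} (K - {e})"
      using b by (subst bij_betw_cong[where g = g]) auto
    then have "bij_betw (g(m := e)) (insert m {..<m}) (insert e (K - {e}))"
      using notIn_Un_bij_betw3[of m "{..<m}" "g(m := e)" "K - {e}"] by auto
    then have "bij_betw (g(m := e)) {..<Suc m} K" using p(2) by (simp add: insert_absorb lessThan_Suc)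
    then show "(case p of (e, g) \<Rightarrow> g(m := e)) \<in> bijections (Suc m) K"
      using p ext by (auto simp: bijections_def bij_betw_def PiE_def extensional_def)
    show "((case p of (e, g) \<Rightarrow> g(m := e)) m, restrict (case p of (e, g) \<Rightarrow> g(m := e)) {..<m}) = p"
      using p ext by (auto simp: fun_eq_iff extensional_def)
  qed auto
qed

text \<open>As \<open>t_e^2 = 0\<close>, only choices of distinct columns survive in the product;
  the coefficient at \<open>K\<close> is therefore the permanent on the columns
  \<open>K\<close>.\<close>

lemma fold_form_mult:
  assumes "finite E" "K \<subseteq> E"
  shows "fold (form_mult E) forms one_elem K = (\<Sum>f\<in>bijections (length forms) K. \<Prod>i<length forms. (forms ! i) (f i))"
  using assms(2)
proof (induction forms arbitrary: K rule: rev_induct)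
  case Nil
  have "bijections 0 K = (if K = {} then {\<lambda>_. undefined} else {})"
    by (auto simp: bijections_def bij_betw_def)
  then show ?case by (simp add: one_elem_def)
next
  case (snoc y forms)
  let ?m = "length forms" and ?F = "fold (form_mult E) forms one_elem"
  have "fold (form_mult E) (forms @ [y]) one_elem K = (\<Sum>e\<in>E. y e * var_mult e ?F K)"
    by (simp add: form_mult_def)
  also have "\<dots> = (\<Sum>e\<in>K. y e * ?F (K - {e}))"
    using assms(1) snoc.prems by (intro sum.mono_neutral_cong_right) (auto simp: var_mult_def)
  also have "\<dots> = (\<Sum>e\<in>K. \<Sum>g\<in>bijections ?m (K - {e}). y e * (\<Prod>i<?m. (forms ! i) (g i)))"
    using snoc by (intro sum.cong refl) (simp add: sum_distrib_left subset_iff)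
  also have "\<dots> = (\<Sum>f\<in>bijections (Suc ?m) K. y (f ?m) * (\<Prod>i<?m. (forms ! i) (restrict f {..<?m} i)))"
    using sum_bijections_Suc[of K "\<lambda>e g. y e * (\<Prod>i<?m. (forms ! i) (g i))" ?m] snoc.prems assms(1)
    by (simp add: finite_subset)
  also have "\<dots> = (\<Sum>f\<in>bijections (Suc ?m) K. \<Prod>i<Suc ?m. ((forms @ [y]) ! i) (f i))"
    by (intro sum.cong refl) (simp add: nth_append mult.commute)
  finally show ?case by simp
qed

text \<open>The hypothesis puts the vector \<open>c\<close> into the kernel of the transpose, whose
  determinant is nonzero.\<close>

lemma nonsingular_rows_independent:
  fixes P :: "nat \<Rightarrow> nat \<Rightarrow> 'a::field"
  assumes "nonsingular n P" and "\<And>j. j < n \<Longrightarrow> (\<Sum>i<n. c i * P i j) = 0" and "i < n"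
  shows "c i = 0"
proof -
  define A where "A = mat n n (\<lambda>(i, j). P i j)"
  have A: "A \<in> carrier_mat n n" by (simp add: A_def)
  have "det A = det_n n P"
    unfolding det_n_def det_def'[OF A] atLeast0LessThan
  proof (intro sum.cong refl arg_cong2[where f = "(*)"] prod.cong)
    fix p i assume "p \<in> {p. p permutes {..<n}}" "i \<in> {..<n}"
    then have "p i < n" "i < n" using permutes_in_image[of p "{..<n}" i] by simp_all
    then show "A $$ (i, p i) = P i (p i)" by (simp add: A_def)
  qed
  with assms(1) have "det (transpose_mat A) \<noteq> 0"
    using det_transpose[OF A] by (simp add: nonsingular_def)
  moreover have "transpose_mat A *\<^sub>v vec n c = 0\<^sub>v n"
  proof (rule eq_vecI)
    fix j assume "j < dim_vec (0\<^sub>v n :: 'a vec)"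
    then have j: "j < n" by simp
    then have "(transpose_mat A *\<^sub>v vec n c) $ j = (\<Sum>i<n. c i * P i j)"
      by (simp add: A_def scalar_prod_def atLeast0LessThan mult.commute[of "c _"])
    then show "(transpose_mat A *\<^sub>v vec n c) $ j = 0\<^sub>v n $ j" using assms(2)[OF j] j by simp
  qed (simp add: A_def)
  ultimately have "vec n c = 0\<^sub>v n"
    using det_0_iff_vec_prod_zero_field[of "transpose_mat A" n] A vec_carrier[of n c]
    unfolding transpose_carrier_mat by (simp only:) blast
  then have "vec n c $ i = 0\<^sub>v n $ i" by (simp only:)
  then show ?thesis using assms(3) by simp
qed

text \<open>Listing \<open>K\<close> in increasing order identifies permutations of positions with
  bijections onto \<open>K\<close>.\<close>

lemma permanent_submatrix_eq:
  assumes K: "finite K" "card K = m"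
  shows "permanent m (submatrix A [0..<m] (sorted_list_of_set K)) = (\<Sum>f\<in>bijections m K. \<Prod>i<m. A i (f i))"
proof -
  define cs where "cs = sorted_list_of_set K"
  have cs: "bij_betw ((!) cs) {..<m} K"
    by (rule bij_betw_nth) (simp_all add: cs_def K)
  show ?thesis
    unfolding permanent_def cs_def[symmetric]
  proof (rule sum.reindex_bij_witness[where j = "\<lambda>\<sigma>. restrict (\<lambda>i. cs ! \<sigma> i) {..<m}"
        \<comment> \<open>Outside the rows the inverse map must be the identity, as a permutation of
          \<open>{..<m}\<close> fixes all other numbers.\<close>
        and i = "\<lambda>f i. if i < m then inv_into {..<m} ((!) cs) (f i) else i"])
    fix \<sigma> assume "\<sigma> \<in> {\<sigma>. \<sigma> permutes {..<m}}"
    then have \<sigma>: "\<sigma> permutes {..<m}" by simp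
    have \<sigma>i: "\<sigma> i < m" if "i < m" for i using permutes_in_image[OF \<sigma>, of i] that by simp
    have "bij_betw (\<lambda>i. cs ! \<sigma> i) {..<m} K"
      using bij_betw_trans[OF permutes_imp_bij[OF \<sigma>] cs] by (simp add: comp_def)
    then have "bij_betw (restrict (\<lambda>i. cs ! \<sigma> i) {..<m}) {..<m} K" by (simp only: bij_betw_restrict_eq)
    then show "restrict (\<lambda>i. cs ! \<sigma> i) {..<m} \<in> bijections m K"
      unfolding bijections_def by (auto simp: bij_betw_def)
    show "(\<lambda>i. if i < m then inv_into {..<m} ((!) cs) (restrict (\<lambda>i. cs ! \<sigma> i) {..<m} i) else i) = \<sigma>"
    proof
      fix i
      show "(if i < m then inv_into {..<m} ((!) cs) (restrict (\<lambda>i. cs ! \<sigma> i) {..<m} i) else i) = \<sigma> i"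
        using \<sigma>i[of i] bij_betw_imp_inj_on[OF cs] permutes_not_in[OF \<sigma>, of i] by (simp add: inv_into_f_f)
    qed
    show "(\<Prod>i<m. A i (restrict (\<lambda>i. cs ! \<sigma> i) {..<m} i)) = (\<Prod>i<m. submatrix A [0..<m] cs i (\<sigma> i))"
      by (intro prod.cong refl) (simp add: submatrix_def)
  next
    fix f assume "f \<in> bijections m K"
    then have f: "bij_betw f {..<m} K" and ext: "f \<in> extensional {..<m}"
      by (simp_all add: bijections_def PiE_def)
    let ?\<sigma> = "\<lambda>i. if i < m then inv_into {..<m} ((!) cs) (f i) else i"
    have "bij_betw (\<lambda>i. inv_into {..<m} ((!) cs) (f i)) {..<m} {..<m}"
      using bij_betw_trans[OF f bij_betw_inv_into[OF cs]] by (simp add: comp_def)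
    then have "bij_betw ?\<sigma> {..<m} {..<m}"
      by (rule bij_betw_cong[THEN iffD1, rotated]) simp
    then have "?\<sigma> permutes {..<m}" by (rule bij_imp_permutes) simp
    then show "?\<sigma> \<in> {\<sigma>. \<sigma> permutes {..<m}}" by simp
    show "restrict (\<lambda>i. cs ! ?\<sigma> i) {..<m} = f"
    proof
      fix i
      show "restrict (\<lambda>i. cs ! ?\<sigma> i) {..<m} i = f i"
      proof (cases "i < m")
        case True
        then have "f i \<in> (!) cs ` {..<m}" using f cs by (auto simp: bij_betw_def)
        then show ?thesis using True f_inv_into_f[of "f i" "(!) cs" "{..<m}"] by simp
      next
        case False
        then show ?thesis using ext by (simp add: extensional_def)
      qed
    qed
  qed
qed

lemma independent_on_block:
  fixes P :: "nat \<Rightarrow> nat \<Rightarrow> 'a::field"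
  assumes "nonsingular n P" and "\<And>i j. i < n \<Longrightarrow> j < n \<Longrightarrow> A i (k + j) = P i j"
  shows "independent_on {k..<k + n} (map A [0..<n])"
  unfolding independent_on_def
proof (intro allI impI ballI)
  fix cs c assume len: "length cs = length (map A [0..<n])"
    and 0: "\<forall>e\<in>{k..<k + n}. (\<Sum>(c, y)\<leftarrow>zip cs (map A [0..<n]). c * y e) = 0" and c: "c \<in> set cs"
  have "(\<Sum>i<n. cs ! i * P i j) = 0" if j: "j < n" for j
  proof -
    have "(\<Sum>(c, y)\<leftarrow>zip cs (map A [0..<n]). c * y (k + j)) = (\<Sum>i<n. cs ! i * A i (k + j))"
      using len by (simp add: sum_list_sum_nth atLeast0LessThan)
    also have "\<dots> = (\<Sum>i<n. cs ! i * P i j)"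
      by (intro sum.cong refl) (simp add: assms(2) j)
    finally show ?thesis using 0 j by simp
  qed
  then have "cs ! i = 0" if "i < n" for i
    using nonsingular_rows_independent[OF assms(1), of "\<lambda>i. cs ! i"] that by simp
  then show "c = 0" using c len by (auto simp: in_set_conv_nth)
qed

section \<open>The doubled matrix with four nonsingular blocks\<close>

theorem theorem3:
  fixes P R S T :: "nat \<Rightarrow> nat \<Rightarrow> 'a::field"
    and n :: nat
  assumes "CHAR('a) = 3"
    and "n \<ge> 1"
    and "nonsingular n P" and "nonsingular n R" and "nonsingular n S" and "nonsingular n T"
  shows "full_perrank (2*n) (4*n) (block_PRST n P R S T)
       \<and> has_nonzero_perm_submatrix (2*n) (4*n) (block_PRST n P R S T) (2*n)"
proof -
  define A where "A = block_PRST n P R S T"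
  define ys where "ys = map A [0..<n]"
  define E where "E = {..<4 * n}"
  define \<B> where "\<B> = (\<lambda>k. {k * n..<k * n + n}) ` {..<4}"
  have three: "(3 :: 'a) = 0" using of_nat_CHAR[where 'a = 'a] assms(1) by simp
  have finE: "finite E" by (simp add: E_def)
  have ind: "independent_on {k * n..<k * n + n} ys" if k: "k < 4" for k
  proof -
    consider "k = 0" | "k = 1" | "k = 2" | "k = 3" using k by linarith
    then obtain Q where "nonsingular n Q" "\<And>i j. i < n \<Longrightarrow> j < n \<Longrightarrow> A i (k * n + j) = Q i j"
    proof cases
      case 1 then show ?thesis by (intro that[of P] assms(3)) (simp add: A_def block_PRST_def)
    next
      case 2 then show ?thesis by (intro that[of R] assms(4)) (simp add: A_def block_PRST_def)
    next
      case 3 then show ?thesis by (intro that[of S] assms(5)) (simp add: A_def block_PRST_def)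
    next
      case 4 then show ?thesis by (intro that[of T] assms(6)) (simp add: A_def block_PRST_def)
    qed
    then show ?thesis unfolding ys_def by (rule independent_on_block)
  qed
  have disj: "disjnt {k * n..<k * n + n} {l * n..<l * n + n}" if "k < l" for k l
  proof -
    have "k * n + n \<le> l * n" using mult_le_mono1[of "Suc k" l n] that by simp
    then show ?thesis by (auto simp: disjnt_def)
  qed
  then have disj': "disjnt {k * n..<k * n + n} {l * n..<l * n + n}" if "k \<noteq> l" for k l
    using that by (metis disjnt_sym nat_neq_iff)
  \<comment> \<open>For \<open>n \<ge> 1\<close> the blocks are nonempty, so disjointness makes them
    distinct and there really are four.\<close>
  have "inj_on (\<lambda>k. {k * n..<k * n + n}) {..<4}"
  proof (rule inj_onI, rule ccontr)
    fix k l assume "{k * n..<k * n + n} = {l * n..<l * n + n}" "k \<noteq> l"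
    with disj'[of k l] have "{k * n..<k * n + n} = {}" by (simp add: disjnt_def)
    then show False using assms(2) by simp
  qed
  then have card\<B>: "card \<B> \<ge> 4" by (simp add: \<B>_def card_image)
  have disj\<B>: "pairwise disjnt \<B>"
  proof (rule pairwiseI)
    fix B C assume "B \<in> \<B>" "C \<in> \<B>" "B \<noteq> C"
    then obtain k l where "B = {k * n..<k * n + n}" "C = {l * n..<l * n + n}" by (auto simp: \<B>_def)
    with \<open>B \<noteq> C\<close> show "disjnt B C" using disj'[of k l] by blast
  qed
  have "\<Union>\<B> \<subseteq> E"
  proof
    fix e assume "e \<in> \<Union>\<B>"
    then obtain k where k: "k < 4" "e < k * n + n" by (auto simp: \<B>_def)
    from k(1) have "Suc k * n \<le> 4 * n" by (intro mult_le_mono1) simp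
    with k(2) have "e < 4 * n" unfolding mult_Suc by linarith
    then show "e \<in> E" by (simp add: E_def)
  qed
  \<comment> \<open>At the start no column is deleted, so for \<open>j = 0\<close> the inequality to
    be met is just \<open>2 * d < 4 * n\<close>.\<close>
  then have cov: "\<Union>\<B> \<inter> support ys - E = {}" by blast
  have vanish: "cohomology_vanishes (form_mult E) (homogeneous E) ys 0 d" if d: "d < 2 * int (length ys)" for d
  proof (rule vanishes_form_mult[OF three _ disj\<B> card\<B> _ finE])
    show "finite \<B>" and "\<And>B. B \<in> \<B> \<Longrightarrow> finite B" by (auto simp: \<B>_def)
    show "independent_on B ys" if "B \<in> \<B>" for B using that ind by (auto simp: \<B>_def)
    show "2 * d + 3 * int 0 + int (card (\<Union>\<B> \<inter> support ys - E)) < 4 * int (length ys)"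
      unfolding cov using d by simp
  qed
  interpret graded_operators "form_mult E :: (nat \<Rightarrow> 'a) \<Rightarrow> _" "homogeneous E"
    using graded_operators_form_mult[OF finE three] .
  let ?q = "fold (form_mult E) (ys @ ys) one_elem"
  have "homogeneous E 0 (one_elem :: nat set \<Rightarrow> 'a)"
    by (simp add: homogeneous_def one_elem_def)
  moreover from this have hom: "homogeneous E (2 * int n) ?q"
    using gr_fold[of 0 one_elem "ys @ ys"] by (simp add: ys_def)
  moreover have "(one_elem :: nat set \<Rightarrow> 'a) \<noteq> 0"
    by (auto simp: fun_eq_iff one_elem_def)
  ultimately have "?q \<noteq> 0" using product_of_squares_nonzero vanish by blast
  then obtain K where K: "?q K \<noteq> 0" by (auto simp: fun_eq_iff)
  then have KE: "K \<subseteq> E" and cardK: "card K = 2 * n"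
    using hom unfolding homogeneous_def by auto
  have finK: "finite K" using KE finE by (rule finite_subset)
  \<comment> \<open>Repeating the list of forms gives the doubled matrix, whose rows depend only on
    \<open>i mod n\<close>.\<close>
  have row: "(ys @ ys) ! i = A i" if "i < 2 * n" for i
    using that by (auto simp: ys_def nth_append A_def block_PRST_def mod_if)
  have "?q K = (\<Sum>f\<in>bijections (2 * n) K. \<Prod>i<2 * n. A i (f i))"
    unfolding fold_form_mult[OF finE KE] using row by (simp add: ys_def mult_2)
  also have "\<dots> = permanent (2 * n) (submatrix A [0..<2 * n] (sorted_list_of_set K))"
    using permanent_submatrix_eq[of K "2 * n" A] finK cardK by (simp add: ys_def)
  finally have "permanent (2 * n) (submatrix A [0..<2 * n] (sorted_list_of_set K)) \<noteq> 0"
    using K by simp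
  then have *: "has_nonzero_perm_submatrix (2 * n) (4 * n) A (2 * n)"
    unfolding has_nonzero_perm_submatrix_def using KE finK cardK
    by (intro exI[of _ "[0..<2 * n]"] exI[of _ "sorted_list_of_set K"]) (auto simp: E_def)
  \<comment> \<open>A square submatrix has at most as many rows as the matrix; this bounds the set
    and so makes \<open>Max\<close> meaningful.\<close>
  have le: "k \<le> 2 * n" if "has_nonzero_perm_submatrix (2 * n) (4 * n) A k" for k
  proof -
    from that obtain rs where rs: "length rs = k" "sorted_wrt (<) rs" "set rs \<subseteq> {..<2 * n}"
      unfolding has_nonzero_perm_submatrix_def by blast
    then have "k = card (set rs)"
      by (simp add: distinct_card strict_sorted_iff)
    also have "\<dots> \<le> 2 * n" using card_mono[OF _ rs(3)] by simp
    finally show ?thesis .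
  qed
  have "Max {k. has_nonzero_perm_submatrix (2 * n) (4 * n) A k} = 2 * n"
    using * le by (intro Max_eqI) (auto intro: finite_subset[of _ "{..2 * n}"])
  with * show ?thesis
    by (simp add: full_perrank_def perrank_def A_def)
qed

end
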